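(* Let $\xi:[0,1]\to\mathbb{R}$ be a smooth strictly monotone function with $\int_0^1\xi(y)\,dy=0$, and let $C>0$. Then for all sufficiently small $r_0>0$ the following holds for every $\hat G\in\hat{\mathcal S}_{r_0}$. Assume that $L_0=L_1=0$. Let $U=[\epsilon,1-\epsilon]\subset(0,1)$ with $\epsilon>0$ small, and let $x\in(0,1)$. Then for Lebesgue almost all $y\in[0,1]$, the number of $i\ge0$ with $\hat g^i_y(x)\in U$ is infinite, but $$\lim_{n\to\infty}\frac1n\sum_{i=0}^{n-1}\mathbf 1_U(\hat g^i_y(x))=0,$$ where $\mathbf 1_U$ is the characteristic function of $U$.
   Context: $E_2:[0,1]\to[0,1]$ is the doubling map $E_2(y)=2y-\lfloor 2y\rfloor$. For fixed $\xi$ and $C>0$, and for $r_0>0$, $\hat{\mathcal S}_{r_0}$ is the set of skew product maps $\hat G:[0,1]\times[0,1]\to[0,1]\times[0,1]$, $\hat G(y,x)=(E_2(y),\hat g_y(x))$, where $(y,x)\mapsto\hat g_y(x)$ is smooth, each $\hat g_y:[0,1]\to[0,1]$ is strictly increasing, and $$\hat g_y(x)=\frac{e^{\xi(y)}x}{1+(e^{\xi(y)}-1)x}+r(y,x)$$ with $|r(y,x)|\le Cx^2$, $|r(y,x)|\le C|1-x|$, and $|r(y,x)|,|\partial_x r(y,x)|,|\partial_y r(y,x)|\le r_0$ for all $(y,x)$. (In particular $\hat g_y(0)=0$, $\hat g_y(1)=1$.) Iterates: $\hat g^n_y=\hat g_{E_2^{n-1}(y)}\circ\cdots\circ\hat g_y$,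 with $\hat g^0_y=\mathrm{id}$. The fiber Lyapunov exponents are $L_0=\int_0^1\ln\hat g_y'(0)\,dy$ (which equals $\int_0^1\xi(y)\,dy=0$) and $L_1=\int_0^1\ln\hat g_y'(1)\,dy$, where $'$ denotes the derivative in $x$. *)

theory Defs
  imports "HOL-Analysis.Analysis"
begin

(* Continuous differentiability of order k on a set that need not be open: derivatives are
   Frechet derivatives relative to S.  On the sets used here (the unit interval and the unit
   square, which are convex with nonempty interior) they are uniquely determined, and
   smoothness means that all derivatives exist in the interior and extend continuously to S. *)

primrec Ck_on ::
  "nat \<Rightarrow> 'a::real_normed_vector set \<Rightarrow> ('a \<Rightarrow> 'b::real_normed_vector) \<Rightarrow> bool" where
  "Ck_on 0 S f \<longleftrightarrow> continuous_on S f"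
| "Ck_on (Suc k) S f \<longleftrightarrow>
     (\<exists>f'. (\<forall>x\<in>S. (f has_derivative f' x) (at x within S)) \<and>
           (\<forall>v. Ck_on k S (\<lambda>x. f' x v)))"

definition smooth_on ::
  "'a::real_normed_vector set \<Rightarrow> ('a \<Rightarrow> 'b::real_normed_vector) \<Rightarrow> bool" where
  "smooth_on S f \<longleftrightarrow> (\<forall>k. Ck_on k S f)"

(* Derivative of a function on [0,1]; one-sided at the end points. *)
definition deriv01 :: "(real \<Rightarrow> real) \<Rightarrow> real \<Rightarrow> real" where
  "deriv01 f t = vector_derivative f (at t within {0..1})"

definition E2 :: "real \<Rightarrow> real" where
  "E2 y = 2 * y - of_int \<lfloor>2 * y\<rfloor>"

definition fibre :: "(real \<times> real \<Rightarrow> real \<times> real) \<Rightarrow> real \<Rightarrow> real \<Rightarrow> real" where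
  "fibre G y x = snd (G (y, x))"

definition remainder ::
  "(real \<Rightarrow> real) \<Rightarrow> (real \<times> real \<Rightarrow> real \<times> real) \<Rightarrow> real \<Rightarrow> real \<Rightarrow> real" where
  "remainder \<xi> G y x = fibre G y x - exp (\<xi> y) * x / (1 + (exp (\<xi> y) - 1) * x)"

(* A self-map of the unit square is represented by a total function whose values off the
   square are irrelevant: every condition below only concerns the square. *)
definition skew_maps ::
  "(real \<Rightarrow> real) \<Rightarrow> real \<Rightarrow> real \<Rightarrow> (real \<times> real \<Rightarrow> real \<times> real) set" where
  "skew_maps \<xi> C r0 = {G.
     (\<forall>y\<in>{0..1}. \<forall>x\<in>{0..1}. fst (G (y, x)) = E2 y \<and> fibre G y x \<in> {0..1}) \<and>
     smooth_on ({0..1} \<times> {0..1}) (\<lambda>(y, x). fibre G y x) \<and>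
     (\<forall>y\<in>{0..1}. strict_mono_on {0..1} (fibre G y)) \<and>
     (\<forall>y\<in>{0..1}. \<forall>x\<in>{0..1}.
        \<bar>remainder \<xi> G y x\<bar> \<le> C * x\<^sup>2 \<and>
        \<bar>remainder \<xi> G y x\<bar> \<le> C * \<bar>1 - x\<bar> \<and>
        \<bar>remainder \<xi> G y x\<bar> \<le> r0 \<and>
        \<bar>deriv01 (\<lambda>t. remainder \<xi> G y t) x\<bar> \<le> r0 \<and>
        \<bar>deriv01 (\<lambda>t. remainder \<xi> G t x) y\<bar> \<le> r0)}"

primrec fibre_iter ::
  "(real \<times> real \<Rightarrow> real \<times> real) \<Rightarrow> nat \<Rightarrow> real \<Rightarrow> real \<Rightarrow> real" where
  "fibre_iter G 0 y = id"
| "fibre_iter G (Suc n) y = fibre G ((E2 ^^ n) y) \<circ> fibre_iter G n y"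

(* The fibre Lyapunov exponents at the invariant end points are those with p = 0 and p = 1. *)
definition lyapunov :: "(real \<times> real \<Rightarrow> real \<times> real) \<Rightarrow> real \<Rightarrow> real" where
  "lyapunov G p = integral {0..1} (\<lambda>y. ln (deriv01 (fibre G y) p))"

end

theory Submission
  imports Defs
begin

text \<open>
  In the coordinate \<open>u = ln x - ln (1 - x)\<close> the fibre maps move points by a bounded amount which is
  exponentially close to \<open>ln D(y, 0)\<close> near \<open>-\<infinity>\<close> and to \<open>- ln D(y, 1)\<close> near \<open>+\<infinity>\<close>, where \<open>D\<close> is the
  fibre derivative; both have mean zero. Over a dyadic interval of level \<open>i\<close>, which \<open>E2 ^^ i\<close> maps
  affinely onto the unit interval, the \<open>i\<close>-th image of a point is a curve over the current base point.
  Its Lipschitz constant stays bounded, because the base expands by 2 and the fibres by at most 3/2.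
  The mean of this curve is a process on the dyadic tree with bounded increments and with drift
  \<open>O(exp (- \<bar>a\<bar>))\<close> at height \<open>a\<close>. As \<open>\<xi> 0\<close> and \<open>\<xi> 1\<close> have opposite signs, following one of the fixed end
  points 0 and 1 of the branches for a fixed number of steps moves the mean up or down by at least 1,
  so the process is never degenerate.

  For such a process the logarithm is a supermartingale far from the origin, which gives recurrence.
  A convex function of linear growth is a submartingale whose value after \<open>n\<close> steps has mean
  \<open>O(sqrt n)\<close>; its increments bound the expected number of visits to a compact set by \<open>O(sqrt n)\<close>,
  which gives density zero.
\<close>

section \<open>Nearly driftless processes on a regular tree\<close>

text \<open>The binary digits of \<open>y\<close> behave like independent fair coin tosses, but the
  displacement at time \<open>i\<close> depends on the base point \<open>(E2 ^^ i) y\<close>, that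
  is, on all later digits; the orbit is therefore not adapted to the dyadic filtration. Averaging
  the image curve over the base points gives a quantity that depends on the first \<open>i\<close>
  digits alone and stays within a fixed distance of the orbit. Conditional expectations then become
  finite averages over the children of a node, and measure theory enters only when fractions of
  nodes become Lebesgue measures of cells. One step over an end point may move a curve by as little
  as \<open>b\<close>, which is lost in the distance between a curve and its mean; hence several
  dyadic levels are merged into one level of a \<open>Q\<close>-ary tree. Smallness of
  \<open>r0\<close> amounts to two requirements: one controls the errors relative to the unperturbed
  maps in the logit coordinate and yields the constant 3/2, the other preserves the opposite
  directions of motion over the two ends of the base.\<close>

text \<open>The node \<open>k < Q ^ n\<close> of level \<open>n\<close> has the children \<open>Q * k + j\<close> with \<open>j < Q\<close>.\<close>

definition avg :: "nat \<Rightarrow> nat \<Rightarrow> (nat \<Rightarrow> real) \<Rightarrow> real" where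
  "avg Q n f = (\<Sum>k<Q ^ n. f k) / real (Q ^ n)"

lemma avg_mono: "(\<And>k. f k \<le> g k) \<Longrightarrow> avg Q n f \<le> avg Q n g"
  unfolding avg_def by (intro divide_right_mono sum_mono) auto

lemma avg_add: "avg Q n (\<lambda>k. f k + g k) = avg Q n f + avg Q n g"
  unfolding avg_def by (simp add: sum.distrib add_divide_distrib)

lemma avg_cmult: "avg Q n (\<lambda>k. b * f k) = b * avg Q n f"
  unfolding avg_def by (simp add: sum_distrib_left)

lemma avg_const: "0 < Q \<Longrightarrow> avg Q n (\<lambda>k. b) = b"
  unfolding avg_def by simp

lemma avg_nonneg: "(\<And>k. 0 \<le> f k) \<Longrightarrow> 0 \<le> avg Q n f"
  unfolding avg_def by (intro divide_nonneg_nonneg sum_nonneg) auto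

lemma avg_Suc:
  assumes "0 < Q"
  shows "avg Q (Suc n) f = avg Q n (\<lambda>k. (\<Sum>j<Q. f (Q * k + j)) / real Q)"
proof -
  have "(\<Sum>k<Q ^ Suc n. f k) = (\<Sum>k<Q ^ n. sum f {k * Q..<k * Q + Q})"
    by (simp add: sum.nat_group mult.commute)
  also have "\<dots> = (\<Sum>k<Q ^ n. \<Sum>j<Q. f (Q * k + j))"
  proof (rule sum.cong)
    fix k
    show "sum f {k * Q..<k * Q + Q} = (\<Sum>j<Q. f (Q * k + j))"
      using sum.shift_bounds_nat_ivl[of f 0 "k * Q" Q]
      by (simp only: add_0 lessThan_atLeast0 add.commute mult.commute)
  qed simp
  finally show ?thesis
    unfolding avg_def by (simp add: sum_divide_distrib divide_divide_eq_left)
qed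

text \<open>A convex substitute for the positive part, with slope \<open>1 - exp (- t)\<close> in
  [0, 1) for \<open>0 \<le> t\<close>. The exponential is chosen to decay at the same rate as the
  drift bound \<open>c * exp (- \<bar>a n k\<bar>)\<close>.\<close>

definition hinge :: "real \<Rightarrow> real" where
  "hinge t = (if t \<le> 0 then 0 else t - 1 + exp (- t))"

lemma hinge_nonneg: "0 \<le> hinge t"
  using exp_ge_add_one_self[of "- t"] by (auto simp: hinge_def)

lemma hinge_le_formula: "hinge t \<le> t - 1 + exp (- t)"
  using exp_ge_add_one_self[of "- t"] by (auto simp: hinge_def)

lemma hinge_eq: "0 \<le> t \<Longrightarrow> hinge t = t - 1 + exp (- t)"
  by (auto simp: hinge_def)

lemma hinge_le: "0 \<le> t \<Longrightarrow> hinge t \<le> t"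
  by (auto simp: hinge_def)

lemma hinge_Lipschitz: "\<bar>hinge s - hinge t\<bar> \<le> \<bar>s - t\<bar>"
proof -
  have *: "0 \<le> hinge t - hinge s \<and> hinge t - hinge s \<le> t - s" if "s \<le> t" for s t
  proof (cases "0 \<le> s")
    case True
    have "exp (- t) \<le> exp (- s)" using that by simp
    moreover have "exp (- s) - exp (- t) \<le> t - s"
    proof -
      have "exp (- s) * (1 - (t - s)) \<le> exp (- s) * exp (- (t - s))"
        using exp_ge_add_one_self[of "- (t - s)"] by (intro mult_left_mono) (linarith, simp)
      also have "\<dots> = exp (- t)" by (simp flip: exp_add)
      finally have "exp (- s) - exp (- t) \<le> exp (- s) * (t - s)" by (simp add: algebra_simps)
      also have "\<dots> \<le> 1 * (t - s)" using that True by (intro mult_right_mono) auto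
      finally show ?thesis by simp
    qed
    ultimately show ?thesis using True that by (simp add: hinge_eq)
  next
    case False
    then have "hinge s = 0" "hinge t \<le> max 0 t" using hinge_le[of t] by (auto simp: hinge_def)
    then show ?thesis using hinge_nonneg[of t] that False by linarith
  qed
  show ?thesis using *[of s t] *[of t s] by linarith
qed

text \<open>The right side is the gap between \<open>exp (- d)\<close> and its tangent at 0. It
  increases for \<open>0 \<le> d\<close> and equals \<open>exp (- 1)\<close> at
  \<open>d = 1\<close>, so a jump of at least 1 gains a fixed amount from convexity.\<close>

lemma exp_remainder_mono:
  fixes d :: real
  assumes "1 \<le> d"
  shows "exp (- 1) \<le> exp (- d) - 1 + d"
proof -
  have "exp (- 1) * (1 + (1 - d)) \<le> exp (- 1) * exp (1 - d)"
    using exp_ge_add_one_self[of "1 - d"] by (intro mult_left_mono) auto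
  also have "\<dots> = exp (- d)" by (simp flip: exp_add)
  finally have "exp (- 1) - exp (- d) \<le> exp (- 1) * (d - 1)" by (simp add: algebra_simps)
  also have "\<dots> \<le> 1 * (d - 1)" using assms by (intro mult_right_mono) auto
  finally show ?thesis by simp
qed

lemma hinge_subgradient:
  assumes "0 \<le> t"
  shows "hinge t + (1 - exp (- t)) * d \<le> hinge (t + d)"
proof (cases "0 \<le> t + d")
  case True
  have "0 \<le> exp (- t) * (exp (- d) - 1 + d)"
    using exp_ge_add_one_self[of "- d"] by simp
  then show ?thesis using True assms
    by (simp add: hinge_eq algebra_simps exp_add exp_diff exp_minus inverse_eq_divide)
next
  case False
  \<comment> \<open>The hinge vanishes at \<open>t + d\<close>, so the tangent at \<open>t\<close>
    has to be nonpositive there. Its slope is nonnegative, which makes \<open>d = - t\<close> the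
    worst case.\<close>
  have "(1 - exp (- t)) * d \<le> (1 - exp (- t)) * (- t)"
    using assms False by (intro mult_left_mono) auto
  moreover have "exp (- t) * (1 + t) \<le> exp (- t) * exp t"
    using exp_ge_add_one_self[of t] by (intro mult_left_mono) auto
  ultimately have "hinge t + (1 - exp (- t)) * d \<le> 0"
    using assms by (simp add: hinge_eq algebra_simps exp_minus)
  then show ?thesis using hinge_nonneg[of "t + d"] by linarith
qed

text \<open>The gap above the tangent is exactly \<open>exp (- t) * (exp (- d) - 1 + d)\<close>, and
  \<open>exp_remainder_mono\<close> bounds the second factor.\<close>

lemma hinge_subgradient_strict:
  assumes "0 \<le> t" "1 \<le> d"
  shows "hinge t + (1 - exp (- t)) * d + exp (- t - 1) \<le> hinge (t + d)"
proof -
  have "exp (- t) * exp (- 1) \<le> exp (- t) * (exp (- d) - 1 + d)"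
    using exp_remainder_mono[OF assms(2)] by (intro mult_left_mono) auto
  then show ?thesis using assms
    by (simp add: hinge_eq algebra_simps exp_add exp_diff exp_minus inverse_eq_divide)
qed

text \<open>Quantifies the strict concavity of \<open>ln\<close>: the bound \<open>x\<close> alone
  would leave nothing to set against the drift. With the constant 6 the difference of the two sides
  has derivative \<open>t * (2 - t) / (3 * (1 + t))\<close>.\<close>

lemma ln_one_plus_le: "0 \<le> x \<Longrightarrow> x \<le> 1 \<Longrightarrow> ln (1 + x) \<le> x - x\<^sup>2 / 6" for x :: real
proof -
  assume x: "0 \<le> x" "x \<le> 1"
  define f where "f = (\<lambda>x::real. x - x\<^sup>2 / 6 - ln (1 + x))"
  have "f 0 \<le> f x"
  proof (rule DERIV_nonneg_imp_nondecreasing[OF x(1)])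
    fix t :: real assume t: "0 \<le> t" "t \<le> x"
    have "(f has_real_derivative (1 - t / 3 - 1 / (1 + t))) (at t)"
      unfolding f_def using t by (auto intro!: derivative_eq_intros simp: field_simps)
    moreover have "0 \<le> 1 - t / 3 - 1 / (1 + t)"
    proof -
      have "1 - t / 3 - 1 / (1 + t) = t * (2 - t) / (3 * (1 + t))" using t
        by (simp add: field_simps)
      also have "\<dots> \<ge> 0" using t x by (intro divide_nonneg_nonneg mult_nonneg_nonneg) auto
      finally show ?thesis .
    qed
    ultimately show "\<exists>y. (f has_real_derivative y) (at t) \<and> 0 \<le> y" by blast
  qed
  then show ?thesis by (simp add: f_def)
qed

text \<open>\<open>a n k\<close> is the value at node \<open>k\<close> of level \<open>n\<close>.
  \<open>drift\<close> bounds the sum over the children, not their mean; \<open>up\<close> and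
  \<open>down\<close> express nondegeneracy. All conditions range over every \<open>k\<close>, so
  that no index bounds have to be carried along.\<close>

locale drift_tree =
  fixes Q :: nat and a :: "nat \<Rightarrow> nat \<Rightarrow> real" and R c :: real
  assumes Q_pos: "0 < Q" and c_nonneg: "0 \<le> c"
    and step: "j < Q \<Longrightarrow> \<bar>a (Suc n) (Q * k + j) - a n k\<bar> \<le> R"
    and drift: "\<bar>\<Sum>j<Q. a (Suc n) (Q * k + j) - a n k\<bar> \<le> c * exp (- \<bar>a n k\<bar>)"
    and up: "\<exists>j<Q. a n k + 1 \<le> a (Suc n) (Q * k + j)"
    and down: "\<exists>j<Q. a (Suc n) (Q * k + j) \<le> a n k - 1"
begin

lemma R_ge_1: "1 \<le> R"
proof -
  obtain j where "j < Q" "a 0 0 + 1 \<le> a (Suc 0) (Q * 0 + j)" using up by blast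
  then show ?thesis using step[of j 0 0] by linarith
qed

text \<open>The assumptions are symmetric under a change of sign, so a statement on returns from
  above also yields returns from below.\<close>

lemma reflect: "drift_tree Q (\<lambda>n k. - a n k) R c"
proof
  fix n k j
  show "\<exists>j<Q. - a n k + 1 \<le> - a (Suc n) (Q * k + j)" using down[of n k] by force
  show "\<exists>j<Q. - a (Suc n) (Q * k + j) \<le> - a n k - 1" using up[of n k] by force
  show "j < Q \<Longrightarrow> \<bar>- a (Suc n) (Q * k + j) - - a n k\<bar> \<le> R" using step[of j n k] by linarith
  have "(\<Sum>j<Q. - a (Suc n) (Q * k + j) - - a n k) = - (\<Sum>j<Q. a (Suc n) (Q * k + j) - a n k)"
    by (simp flip: sum_negf)
  then show "\<bar>\<Sum>j<Q. - a (Suc n) (Q * k + j) - - a n k\<bar> \<le> c * exp (- \<bar>- a n k\<bar>)"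
    using drift[of n k] by simp
qed (use Q_pos c_nonneg in auto)

text \<open>With \<open>t = a n k\<close>, a child at least one unit higher gains
  \<open>1 / (6 * t\<^sup>2)\<close> from the concavity of \<open>ln\<close>. The drift costs at
  most \<open>c * exp (- t) / t\<close>, which the second condition on \<open>K\<close> bounds by
  half of that gain. The first condition keeps all children positive and puts the high child in the
  range of the quadratic bound.\<close>

lemma log_drift:
  assumes K: "R + 1 \<le> K" "\<And>t. K \<le> t \<Longrightarrow> c * exp (- t) * t \<le> 1 / 12" and "K \<le> a n k"
  shows "(\<Sum>j<Q. ln (a (Suc n) (Q * k + j))) \<le> real Q * ln (a n k) - 1 / (12 * (a n k)\<^sup>2)"
proof -
  define t where "t = a n k"
  define d where "d j = a (Suc n) (Q * k + j) - t" for j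
  have t: "K \<le> t" "R + 1 \<le> t" "0 < t" using assms R_ge_1 by (auto simp: t_def)
  have d: "\<bar>d j\<bar> \<le> R" if "j < Q" for j using step[OF that] by (simp add: d_def t_def)
  have ln_split: "ln (t + d j) = ln t + ln (1 + d j / t)" if "j < Q" for j
  proof -
    have "0 < 1 + d j / t" using d[OF that] t by (simp add: field_simps)
    moreover have "t + d j = t * (1 + d j / t)" using t by (simp add: field_simps)
    ultimately show ?thesis using t by (simp add: ln_mult)
  qed
  have le: "ln (t + d j) \<le> ln t + d j / t" if "j < Q" for j
  proof -
    have "-1 < d j / t" using d[OF that] t by (simp add: field_simps)
    then show ?thesis using ln_split[OF that] ln_add_one_self_le_self2[of "d j / t"] by simp
  qed
  obtain j0 where j0: "j0 < Q" "t + 1 \<le> t + d j0" using up[of n k] by (auto simp: d_def t_def)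
  have le0: "ln (t + d j0) \<le> ln t + d j0 / t - 1 / (6 * t\<^sup>2)"
  proof -
    have "d j0 \<le> t" using d[OF j0(1)] t by linarith
    then have "ln (1 + d j0 / t) \<le> d j0 / t - (d j0 / t)\<^sup>2 / 6"
      using j0 t by (intro ln_one_plus_le) auto
    moreover have "1 / t\<^sup>2 \<le> (d j0 / t)\<^sup>2"
      using j0 t by (simp add: power_divide divide_right_mono)
    ultimately show ?thesis using ln_split[OF j0(1)] by simp
  qed
  have "(\<Sum>j<Q. ln (t + d j)) = ln (t + d j0) + (\<Sum>j\<in>{..<Q} - {j0}. ln (t + d j))"
    using j0 by (simp add: sum.remove)
  also have "\<dots> \<le> (ln t + d j0 / t - 1 / (6 * t\<^sup>2)) + (\<Sum>j\<in>{..<Q} - {j0}. ln t + d j / t)"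
    by (intro add_mono le0 sum_mono le) auto
  also have "\<dots> = (\<Sum>j<Q. ln t + d j / t) - 1 / (6 * t\<^sup>2)"
    using j0 by (simp add: sum.remove)
  also have "(\<Sum>j<Q. ln t + d j / t) = real Q * ln t + (\<Sum>j<Q. d j) / t"
    by (simp add: sum.distrib sum_divide_distrib)
  also have "(\<Sum>j<Q. d j) / t \<le> c * exp (- t) / t"
    using drift[of n k] t by (intro divide_right_mono) (auto simp: d_def t_def)
  also have "c * exp (- t) / t = c * exp (- t) * t / t\<^sup>2" using t by (simp add: power2_eq_square)
  also have "\<dots> \<le> (1 / 12) / t\<^sup>2" using K(2)[OF t(1)] by (intro divide_right_mono) auto
  finally show ?thesis by (simp add: d_def t_def)
qed

text \<open>\<open>k div Q ^ (n - i)\<close> is the ancestor of node \<open>k\<close> on level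
  \<open>i\<close>, so the condition concerns the whole path from level \<open>n0\<close>
  on.\<close>

definition alive :: "real \<Rightarrow> nat \<Rightarrow> nat \<Rightarrow> nat \<Rightarrow> bool" where
  "alive K n0 n k \<longleftrightarrow> (\<forall>i\<in>{n0..n}. K < a i (k div Q ^ (n - i)))"

lemma alive_child:
  assumes "n0 \<le> n" "j < Q" "alive K n0 (Suc n) (Q * k + j)"
  shows "alive K n0 n k"
proof -
  have "(Q * k + j) div Q ^ (Suc n - i) = k div Q ^ (n - i)" if "i \<le> n" for i
  proof -
    have "(Q * k + j) div Q ^ (Suc n - i) = ((Q * k + j) div Q) div Q ^ (n - i)"
      using that by (simp add: Suc_diff_le div_mult2_eq)
    then show ?thesis using assms(2) by simp
  qed
  then show ?thesis using assms(3) by (force simp: alive_def)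
qed

lemma alive_self: "n0 \<le> n \<Longrightarrow> alive K n0 n k \<Longrightarrow> K < a n k"
  by (force simp: alive_def)

text \<open>The mean of \<open>ln (a n k)\<close> over the surviving nodes decreases by a multiple of the mean of
  \<open>1 / (a n k)\<^sup>2\<close>. The latter is therefore summable, which is impossible if a positive fraction of
  the nodes survives: most of them would stay below a fixed height.\<close>

lemma alive_tendsto_0:
  assumes K: "R + 1 \<le> K" "\<And>t. K \<le> t \<Longrightarrow> c * exp (- t) * t \<le> 1 / 12"
  shows "(\<lambda>n. avg Q n (\<lambda>k. of_bool (alive K n0 n k))) \<longlonglongrightarrow> 0"
proof -
  define v where "v n = avg Q n (\<lambda>k. of_bool (alive K n0 n k) * ln (a n k))" for n
  define e where "e n = avg Q n (\<lambda>k. of_bool (alive K n0 n k) / (a n k)\<^sup>2)" for n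
  define b where "b = 1 / (12 * real Q)"
  have b: "0 < b" using Q_pos by (simp add: b_def)
  have K1: "1 \<le> K - R" using K by simp
  have v_Suc: "v (Suc n) \<le> v n - b * e n" if n: "n0 \<le> n" for n
  proof -
    have "v (Suc n) = avg Q n (\<lambda>k. (\<Sum>j<Q. of_bool (alive K n0 (Suc n) (Q * k + j)) *
        ln (a (Suc n) (Q * k + j))) / real Q)"
      unfolding v_def by (rule avg_Suc[OF Q_pos])
    also have "\<dots> \<le> avg Q n (\<lambda>k. of_bool (alive K n0 n k) * ln (a n k) +
        (- b) * (of_bool (alive K n0 n k) / (a n k)\<^sup>2))"
    proof (rule avg_mono)
      fix k
      show "(\<Sum>j<Q. of_bool (alive K n0 (Suc n) (Q * k + j)) * ln (a (Suc n) (Q * k + j))) / real Q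
        \<le> of_bool (alive K n0 n k) * ln (a n k) + - b * (of_bool (alive K n0 n k) / (a n k)\<^sup>2)"
      proof (cases "alive K n0 n k")
        case True
        have ak: "K < a n k" using alive_self[OF n True] .
        \<comment> \<open>Children that have fallen to \<open>K\<close> or below may be kept in the
          sum: they lie above \<open>K - R \<ge> 1\<close>, so their logarithms are
          nonnegative.\<close>
        have "(\<Sum>j<Q. of_bool (alive K n0 (Suc n) (Q * k + j)) * ln (a (Suc n) (Q * k + j)))
          \<le> (\<Sum>j<Q. ln (a (Suc n) (Q * k + j)))"
        proof (rule sum_mono)
          fix j assume "j \<in> {..<Q}"
          then have "1 \<le> a (Suc n) (Q * k + j)" using step[of j n k] ak K1 by auto
          then show "of_bool (alive K n0 (Suc n) (Q * k + j)) * ln (a (Suc n) (Q * k + j))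
            \<le> ln (a (Suc n) (Q * k + j))" by auto
        qed
        also have "\<dots> \<le> real Q * ln (a n k) - 1 / (12 * (a n k)\<^sup>2)"
          using ak by (intro log_drift[OF K]) auto
        finally have "(\<Sum>j<Q. of_bool (alive K n0 (Suc n) (Q * k + j)) * ln (a (Suc n) (Q * k + j))) / real Q
          \<le> (real Q * ln (a n k) - 1 / (12 * (a n k)\<^sup>2)) / real Q"
          by (intro divide_right_mono) auto
        also have "\<dots> = ln (a n k) - b / (a n k)\<^sup>2"
          using Q_pos by (simp add: b_def field_simps)
        finally show ?thesis using True by simp
      next
        case False
        then have "\<not> alive K n0 (Suc n) (Q * k + j)" if "j < Q" for j
          using alive_child[OF n that] by blast
        then show ?thesis using False by (simp add: sum.neutral)
      qed
    qed
    also have "\<dots> = v n - b * e n" unfolding avg_add avg_cmult v_def e_def by simp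
    finally show ?thesis .
  qed
  have v_nonneg: "0 \<le> v n" if "n0 \<le> n" for n
    unfolding v_def
  proof (rule avg_nonneg)
    fix k show "0 \<le> of_bool (alive K n0 n k) * ln (a n k)"
      using alive_self[OF that, of K k] K1 R_ge_1 by auto
  qed
  have e_nonneg: "0 \<le> e n" for n unfolding e_def by (intro avg_nonneg) auto
  have tele: "v (n0 + m) + b * (\<Sum>i<m. e (n0 + i)) \<le> v n0" for m
  proof (induction m)
    case (Suc m)
    then show ?case using v_Suc[of "n0 + m"] by (simp add: algebra_simps)
  qed simp
  have "summable (\<lambda>i. e (n0 + i))"
  proof (rule bounded_imp_summable)
    show "sum (\<lambda>i. e (n0 + i)) {..m} \<le> v n0 / b" for m
      using tele[of "Suc m"] v_nonneg[of "n0 + Suc m"] b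
      by (simp add: field_simps lessThan_Suc_atMost)
  qed (rule e_nonneg)
  then have e0: "(\<lambda>n. e (n0 + n)) \<longlonglongrightarrow> 0" by (rule summable_LIMSEQ_zero)
  have v_le: "v (n0 + m) \<le> v n0" for m
  proof -
    have "0 \<le> b * (\<Sum>i<m. e (n0 + i))" using b e_nonneg by (intro mult_nonneg_nonneg sum_nonneg) auto
    then show ?thesis using tele[of m] by linarith
  qed
  \<comment> \<open>Nodes above height \<open>exp l\<close> are counted by Markov's inequality for
    \<open>ln\<close>, the others by \<open>1 \<le> (exp l)\<^sup>2 / z\<^sup>2\<close>. Thus
    \<open>l\<close> can be fixed first, and then \<open>e\<close> tends to 0.\<close>
  have le: "avg Q (n0 + m) (\<lambda>k. of_bool (alive K n0 (n0 + m) k)) \<le> v n0 / l + (exp l)\<^sup>2 * e (n0 + m)"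
    if l: "0 < l" for l m
  proof -
    have "avg Q (n0 + m) (\<lambda>k. of_bool (alive K n0 (n0 + m) k)) \<le>
      avg Q (n0 + m) (\<lambda>k. (1 / l) * (of_bool (alive K n0 (n0 + m) k) * ln (a (n0 + m) k)) +
        (exp l)\<^sup>2 * (of_bool (alive K n0 (n0 + m) k) / (a (n0 + m) k)\<^sup>2))"
    proof (rule avg_mono)
      fix k
      show "of_bool (alive K n0 (n0 + m) k) \<le>
         (1 / l) * (of_bool (alive K n0 (n0 + m) k) * ln (a (n0 + m) k)) +
        (exp l)\<^sup>2 * (of_bool (alive K n0 (n0 + m) k) / (a (n0 + m) k)\<^sup>2)"
      proof (cases "alive K n0 (n0 + m) k")
        case True
        define z where "z = a (n0 + m) k"
        have z: "1 \<le> z" using alive_self[OF _ True] K1 R_ge_1 by (simp add: z_def)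
        have "1 \<le> (1 / l) * ln z + (exp l)\<^sup>2 / z\<^sup>2"
        proof (cases "z \<le> exp l")
          case True
          then have "1 \<le> (exp l)\<^sup>2 / z\<^sup>2" using z by (simp add: power_mono)
          moreover have "0 \<le> (1 / l) * ln z" using z l by simp
          ultimately show ?thesis by linarith
        next
          case False
          then have "l \<le> ln z" using z by (simp add: ln_ge_iff)
          then have "1 \<le> (1 / l) * ln z" using l by simp
          moreover have "0 \<le> (exp l)\<^sup>2 / z\<^sup>2" by simp
          ultimately show ?thesis by linarith
        qed
        then show ?thesis using True by (simp add: z_def)
      qed simp
    qed
    also have "\<dots> = (1 / l) * v (n0 + m) + (exp l)\<^sup>2 * e (n0 + m)"
      unfolding avg_add avg_cmult v_def e_def by simp
    also have "\<dots> \<le> (1 / l) * v n0 + (exp l)\<^sup>2 * e (n0 + m)"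
      using v_le l by (intro add_right_mono mult_left_mono) auto
    finally show ?thesis by simp
  qed
  have "(\<lambda>m. avg Q (n0 + m) (\<lambda>k. of_bool (alive K n0 (n0 + m) k))) \<longlonglongrightarrow> 0"
  proof (rule LIMSEQ_I)
    fix r :: real assume r: "0 < r"
    define l where "l = 2 * (v n0 + 1) / r"
    have l: "0 < l" using v_nonneg[of n0] r by (simp add: l_def)
    have "v n0 / l < r / 2"
      using v_nonneg[of n0] r by (simp add: l_def field_simps)
    have "(\<lambda>m. (exp l)\<^sup>2 * e (n0 + m)) \<longlonglongrightarrow> (exp l)\<^sup>2 * 0" by (intro tendsto_mult_left e0)
    then have "eventually (\<lambda>m. (exp l)\<^sup>2 * e (n0 + m) < r / 2) sequentially"
      using r by (intro order_tendstoD(2)[where y = 0]) auto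
    then obtain N where N: "\<And>m. m \<ge> N \<Longrightarrow> (exp l)\<^sup>2 * e (n0 + m) < r / 2"
      by (auto simp: eventually_sequentially)
    have "norm (avg Q (n0 + m) (\<lambda>k. of_bool (alive K n0 (n0 + m) k)) - 0) < r" if "m \<ge> N" for m
    proof -
      have "0 \<le> avg Q (n0 + m) (\<lambda>k. of_bool (alive K n0 (n0 + m) k))" by (intro avg_nonneg) auto
      then show ?thesis using le[OF l, of m] N[OF that] \<open>v n0 / l < r / 2\<close> by (simp only: diff_0_right real_norm_def abs_of_nonneg)
    qed
    then show "\<exists>N. \<forall>m\<ge>N. norm (avg Q (n0 + m) (\<lambda>k. of_bool (alive K n0 (n0 + m) k)) - 0) < r" by blast
  qed
  then show ?thesis
    using LIMSEQ_offset[of "\<lambda>n. avg Q n (\<lambda>k. of_bool (alive K n0 n k))" n0 0] by (simp add: add.commute)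
qed

section \<open>Expected number of visits to a compact set\<close>

text \<open>The curvature of the hinge at height \<open>t\<close> is \<open>exp (- t)\<close>, which outweighs the drift once \<open>K\<close> is
  large.\<close>

lemma hinge_drift_ge:
  assumes K: "0 \<le> K" "c * exp (- K) \<le> exp (- 1) / 2"
  shows "real Q * hinge (a n k - K) + exp (- R - 1) / 2 * of_bool (K \<le> a n k \<and> a n k \<le> K + R)
    \<le> (\<Sum>j<Q. hinge (a (Suc n) (Q * k + j) - K))"
proof (cases "K \<le> a n k")
  case False
  then show ?thesis by (simp add: hinge_def[of "a n k - K"] sum_nonneg hinge_nonneg)
next
  case True
  define t where "t = a n k - K"
  define d where "d j = a (Suc n) (Q * k + j) - a n k" for j
  have t: "0 \<le> t" using True by (simp add: t_def)
  obtain j0 where j0: "j0 < Q" "1 \<le> d j0" using up[of n k] by (force simp: d_def)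
  have "real Q * hinge t + (1 - exp (- t)) * (\<Sum>j<Q. d j) + exp (- t - 1)
    = (\<Sum>j<Q. hinge t + (1 - exp (- t)) * d j) + exp (- t - 1)"
    by (simp add: sum.distrib sum_distrib_left)
  also have "\<dots> = (hinge t + (1 - exp (- t)) * d j0 + exp (- t - 1)) +
      (\<Sum>j\<in>{..<Q} - {j0}. hinge t + (1 - exp (- t)) * d j)"
    using j0 by (simp add: sum.remove)
  also have "\<dots> \<le> hinge (t + d j0) + (\<Sum>j\<in>{..<Q} - {j0}. hinge (t + d j))"
    using t j0 by (intro add_mono sum_mono hinge_subgradient hinge_subgradient_strict) auto
  also have "\<dots> = (\<Sum>j<Q. hinge (t + d j))" using j0 by (simp add: sum.remove)
  also have "\<dots> = (\<Sum>j<Q. hinge (a (Suc n) (Q * k + j) - K))"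
    by (simp add: t_def d_def)
  finally have main: "real Q * hinge t + (1 - exp (- t)) * (\<Sum>j<Q. d j) + exp (- t - 1)
    \<le> (\<Sum>j<Q. hinge (a (Suc n) (Q * k + j) - K))" .
  \<comment> \<open>The slope of the hinge is at most 1, so the drift costs at most half of the gain
    \<open>exp (- t - 1)\<close> due to the child \<open>j0\<close>.\<close>
  have "\<bar>(1 - exp (- t)) * (\<Sum>j<Q. d j)\<bar> \<le> 1 * (c * exp (- \<bar>a n k\<bar>))"
    unfolding abs_mult using t drift[of n k] by (intro mult_mono) (auto simp: d_def)
  also have "\<dots> = exp (- t) * (c * exp (- K))"
    using True K(1) by (simp add: t_def flip: exp_add)
  also have "\<dots> \<le> exp (- t) * (exp (- 1) / 2)" by (intro mult_left_mono K) auto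
  also have "\<dots> = exp (- t - 1) / 2" by (simp add: exp_diff exp_minus field_simps)
  finally have "real Q * hinge t + exp (- t - 1) / 2 \<le> (\<Sum>j<Q. hinge (a (Suc n) (Q * k + j) - K))"
    using main by linarith
  \<comment> \<open>The height \<open>R\<close> of the window is dictated by its later extension
    downwards: a jump from below \<open>K\<close> cannot pass over it.\<close>
  moreover have "exp (- R - 1) * of_bool (K \<le> a n k \<and> a n k \<le> K + R) \<le> exp (- t - 1)"
    by (auto simp: t_def)
  ultimately show ?thesis by (simp add: t_def)
qed

text \<open>With \<open>h\<close> the hinge and \<open>\<delta>\<close> its increment, \<open>(h +
  \<delta>)\<^sup>2 = h\<^sup>2 + \<delta>\<^sup>2 + 2 * h * \<delta>\<close>. Each
  \<open>\<delta>\<close> is at most \<open>R\<close> in size. For \<open>0 \<le> t\<close> the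
  increments at the children sum to at most \<open>D * exp (- t)\<close>, which absorbs the factor
  \<open>h \<le> t\<close>.\<close>

lemma hinge_square_le:
  assumes K: "0 \<le> K"
  shows "(\<Sum>j<Q. (hinge (a (Suc n) (Q * k + j) - K))\<^sup>2)
    \<le> real Q * ((hinge (a n k - K))\<^sup>2 + (R\<^sup>2 + 2 * (c + real Q * exp R)))"
proof -
  define t where "t = a n k - K"
  define d where "d j = a (Suc n) (Q * k + j) - a n k" for j
  define D where "D = c + real Q * exp R"
  have D: "0 \<le> D" using c_nonneg by (simp add: D_def)
  have d: "\<bar>d j\<bar> \<le> R" if "j < Q" for j using step[OF that] by (simp add: d_def)
  have lin: "hinge t * (\<Sum>j<Q. hinge (t + d j) - hinge t) \<le> D"
  proof (cases "0 \<le> t")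
    case False
    then show ?thesis using D by (simp add: hinge_def)
  next
    case True
    have "(\<Sum>j<Q. hinge (t + d j) - hinge t) \<le> (\<Sum>j<Q. d j + exp (- t) * exp R)"
    proof (rule sum_mono)
      fix j assume "j \<in> {..<Q}"
      then have "exp (- d j) \<le> exp R" using d[of j] by auto
      then have "exp (- t) * exp (- d j) \<le> exp (- t) * exp R" by simp
      moreover have "exp (- (t + d j)) = exp (- t) * exp (- d j)" by (simp flip: exp_add)
      ultimately show "hinge (t + d j) - hinge t \<le> d j + exp (- t) * exp R"
        using hinge_le_formula[of "t + d j"] hinge_eq[OF True] exp_gt_zero[of "-t"] by linarith
    qed
    also have "\<dots> = (\<Sum>j<Q. d j) + real Q * exp R * exp (- t)" by (simp add: sum.distrib)
    also have "(\<Sum>j<Q. d j) \<le> c * exp (- \<bar>a n k\<bar>)" using drift[of n k] by (simp add: d_def)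
    also have "c * exp (- \<bar>a n k\<bar>) \<le> c * exp (- t)"
      using K c_nonneg by (intro mult_left_mono) (auto simp: t_def)
    finally have "(\<Sum>j<Q. hinge (t + d j) - hinge t) \<le> D * exp (- t)"
      by (simp add: D_def algebra_simps)
    then have "hinge t * (\<Sum>j<Q. hinge (t + d j) - hinge t) \<le> hinge t * (D * exp (- t))"
      by (intro mult_left_mono hinge_nonneg)
    also have "\<dots> \<le> t * (D * exp (- t))"
      using True D by (intro mult_right_mono hinge_le) auto
    also have "\<dots> = D * (t * exp (- t))" by simp
    also have "\<dots> \<le> D * 1"
    proof (intro mult_left_mono D)
      have "t \<le> exp t" using exp_ge_add_one_self[of t] by linarith
      then show "t * exp (- t) \<le> 1" by (simp add: exp_minus field_simps)
    qed
    finally show ?thesis by simp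
  qed
  have "(\<Sum>j<Q. (hinge (t + d j))\<^sup>2) \<le> (\<Sum>j<Q. (hinge t)\<^sup>2 + R\<^sup>2 + 2 * (hinge t * (hinge (t + d j) - hinge t)))"
  proof (rule sum_mono)
    fix j assume "j \<in> {..<Q}"
    then have "\<bar>hinge (t + d j) - hinge t\<bar> \<le> R"
      using hinge_Lipschitz[of "t + d j" t] d[of j] by auto
    then have "(hinge (t + d j) - hinge t)\<^sup>2 \<le> R\<^sup>2" by (meson power2_le_iff_abs_le abs_ge_zero order_trans)
    moreover have "(hinge (t + d j))\<^sup>2 =
      (hinge t)\<^sup>2 + (hinge (t + d j) - hinge t)\<^sup>2 + 2 * (hinge t * (hinge (t + d j) - hinge t))"
      by (simp add: power2_eq_square algebra_simps)
    ultimately show "(hinge (t + d j))\<^sup>2 \<le> (hinge t)\<^sup>2 + R\<^sup>2 + 2 * (hinge t * (hinge (t + d j) - hinge t))"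
      by linarith
  qed
  also have "\<dots> = real Q * ((hinge t)\<^sup>2 + R\<^sup>2) + 2 * (hinge t * (\<Sum>j<Q. hinge (t + d j) - hinge t))"
    by (simp add: sum.distrib distrib_left flip: sum_distrib_left)
  also have "\<dots> \<le> real Q * ((hinge t)\<^sup>2 + R\<^sup>2) + 2 * D" using lin by simp
  also have "\<dots> \<le> real Q * ((hinge t)\<^sup>2 + R\<^sup>2) + real Q * (2 * D)"
    using Q_pos D by (intro add_left_mono) (simp add: mult_le_cancel_right1)
  finally show ?thesis by (simp add: t_def d_def D_def algebra_simps)
qed

text \<open>The mean \<open>s n\<close> of the hinge at level \<open>n\<close> grows by at least a multiple of the fraction of nodes in
  the window, while the mean \<open>s2 n\<close> of its square is at most linear in \<open>n\<close>.\<close>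

lemma visits_base:
  assumes K: "0 \<le> K" "c * exp (- K) \<le> exp (- 1) / 2"
  shows "\<exists>C\<ge>0. \<forall>n. (\<Sum>i<n. avg Q i (\<lambda>k. of_bool (K \<le> a i k \<and> a i k \<le> K + R))) \<le> C * sqrt (real n)"
proof -
  define s where "s n = avg Q n (\<lambda>k. hinge (a n k - K))" for n
  define s2 where "s2 n = avg Q n (\<lambda>k. (hinge (a n k - K))\<^sup>2)" for n
  define w where "w i = avg Q i (\<lambda>k. of_bool (K \<le> a i k \<and> a i k \<le> K + R))" for i
  define \<beta> where "\<beta> = exp (- R - 1) / 2 / real Q"
  define D where "D = R\<^sup>2 + 2 * (c + real Q * exp R)"
  have \<beta>: "0 < \<beta>" using Q_pos by (simp add: \<beta>_def)
  have D: "0 \<le> D" using c_nonneg by (simp add: D_def)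
  have s_Suc: "s n + \<beta> * w n \<le> s (Suc n)" for n
  proof -
    have "s n + \<beta> * w n = avg Q n (\<lambda>k. hinge (a n k - K) + \<beta> * of_bool (K \<le> a n k \<and> a n k \<le> K + R))"
      unfolding s_def w_def avg_add avg_cmult ..
    also have "\<dots> \<le> avg Q n (\<lambda>k. (\<Sum>j<Q. hinge (a (Suc n) (Q * k + j) - K)) / real Q)"
    proof (rule avg_mono)
      fix k
      show "hinge (a n k - K) + \<beta> * of_bool (K \<le> a n k \<and> a n k \<le> K + R)
        \<le> (\<Sum>j<Q. hinge (a (Suc n) (Q * k + j) - K)) / real Q"
        using divide_right_mono[OF hinge_drift_ge[OF K, of n k], of "real Q"] Q_pos
        by (simp add: \<beta>_def add_divide_distrib)
    qed
    also have "\<dots> = s (Suc n)" unfolding s_def by (rule avg_Suc[OF Q_pos, symmetric])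
    finally show ?thesis .
  qed
  have s2_Suc: "s2 (Suc n) \<le> s2 n + D" for n
  proof -
    have "s2 (Suc n) = avg Q n (\<lambda>k. (\<Sum>j<Q. (hinge (a (Suc n) (Q * k + j) - K))\<^sup>2) / real Q)"
      unfolding s2_def by (rule avg_Suc[OF Q_pos])
    also have "\<dots> \<le> avg Q n (\<lambda>k. (hinge (a n k - K))\<^sup>2 + D)"
      using hinge_square_le[OF K(1), of n] Q_pos
      by (intro avg_mono) (simp add: D_def divide_le_eq mult.commute)
    also have "\<dots> = s2 n + D" unfolding s2_def avg_add avg_const[OF Q_pos] ..
    finally show ?thesis .
  qed
  have s2_le: "s2 n \<le> s2 0 + D * real n" for n
  proof (induction n)
    case (Suc n)
    then show ?case using s2_Suc[of n] by (simp add: algebra_simps)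
  qed simp
  have s_sum: "\<beta> * (\<Sum>i<n. w i) \<le> s n" for n
  proof (induction n)
    case 0
    show ?case by (simp add: s_def avg_nonneg hinge_nonneg)
  next
    case (Suc n)
    then show ?case using s_Suc[of n] by (simp add: algebra_simps)
  qed
  have s20: "0 \<le> s2 0" by (simp add: s2_def avg_nonneg)
  have s_le: "s n \<le> (s2 0 + D + 1) * sqrt (real n)" if n: "0 < n" for n
  proof -
    define q where "q = sqrt (real n)"
    have q: "1 \<le> q" "q * q = real n" using n by (auto simp: q_def)
    \<comment> \<open>Young's inequality \<open>h \<le> h\<^sup>2 / q + q\<close> plays the role of
      the Cauchy-Schwarz bound of the first moment by the second; \<open>q = sqrt (real n)\<close>
      balances the two terms.\<close>
    have "s n \<le> avg Q n (\<lambda>k. (1 / q) * (hinge (a n k - K))\<^sup>2 + q)"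
      unfolding s_def
    proof (rule avg_mono)
      fix k
      define h where "h = hinge (a n k - K)"
      have "0 \<le> h" by (simp add: h_def hinge_nonneg)
      have "0 \<le> (h - q)\<^sup>2" by simp
      then have "2 * (h * q) \<le> h\<^sup>2 + q * q" by (simp add: power2_eq_square algebra_simps)
      moreover have "0 \<le> h * q" using \<open>0 \<le> h\<close> q by simp
      ultimately have "h * q \<le> h\<^sup>2 + q * q" by linarith
      then show "h \<le> (1 / q) * h\<^sup>2 + q" using q by (simp add: field_simps)
    qed
    also have "\<dots> = (1 / q) * s2 n + q" unfolding avg_add avg_cmult avg_const[OF Q_pos] s2_def ..
    also have "\<dots> \<le> (1 / q) * (s2 0 + D * (q * q)) + q"
      using s2_le[of n] q by (intro add_right_mono mult_left_mono) auto
    also have "\<dots> = s2 0 / q + D * q + q" using q by (simp add: field_simps)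
    also have "s2 0 / q \<le> s2 0 * q"
    proof -
      have "1 \<le> q * q" using mult_mono[OF q(1) q(1)] q(1) by simp
      then have "s2 0 * 1 \<le> s2 0 * (q * q)" by (intro mult_left_mono s20)
      then show ?thesis using q(1) by (simp add: divide_le_eq mult.assoc)
    qed
    finally show ?thesis by (simp add: q_def algebra_simps)
  qed
  have "(\<Sum>i<n. w i) \<le> (s2 0 + D + 1) / \<beta> * sqrt (real n)" for n
  proof (cases "n = 0")
    case False
    then show ?thesis using s_sum[of n] s_le[of n] \<beta> by (simp add: field_simps)
  qed simp
  then show ?thesis using s20 D \<beta> unfolding w_def by (intro exI[of _ "(s2 0 + D + 1) / \<beta>"]) auto
qed

text \<open>A node just below the window has a child inside it, so the window can be extended downwards.\<close>

lemma visits_shift: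
  assumes K: "0 \<le> K" "c * exp (- K) \<le> exp (- 1) / 2"
  shows "\<exists>C\<ge>0. \<forall>n. (\<Sum>i<n. avg Q i (\<lambda>k. of_bool (K - real m \<le> a i k \<and> a i k \<le> K + R))) \<le> C * sqrt (real n)"
proof (induction m)
  case 0
  then show ?case using visits_base[OF K] by simp
next
  case (Suc m)
  define f where "f i = avg Q i (\<lambda>k. of_bool (K - real m \<le> a i k \<and> a i k \<le> K + R))" for i
  obtain C where C: "0 \<le> C" "\<And>n. (\<Sum>i<n. f i) \<le> C * sqrt (real n)"
    using Suc.IH unfolding f_def by blast
  have f_nonneg: "0 \<le> f i" for i unfolding f_def by (intro avg_nonneg) auto
  \<comment> \<open>A child carries only \<open>1 / Q\<close> of the weight of its parent, hence the
    factor \<open>real Q\<close> when a parent below the window is charged to a child inside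
    it.\<close>
  have le: "avg Q i (\<lambda>k. of_bool (K - real (Suc m) \<le> a i k \<and> a i k \<le> K + R)) \<le> f i + real Q * f (Suc i)" for i
  proof -
    define P where "P z \<longleftrightarrow> K - real m \<le> z \<and> z \<le> K + R" for z
    have "avg Q i (\<lambda>k. of_bool (K - real (Suc m) \<le> a i k \<and> a i k \<le> K + R)) \<le>
      avg Q i (\<lambda>k. of_bool (P (a i k)) + real Q * ((\<Sum>j<Q. of_bool (P (a (Suc i) (Q * k + j)))) / real Q))"
    proof (rule avg_mono)
      fix k
      define T where "T = (\<Sum>j<Q. of_bool (P (a (Suc i) (Q * k + j))) :: real)"
      have T: "0 \<le> T" unfolding T_def by (intro sum_nonneg) auto
      have "1 \<le> T" if "K - real (Suc m) \<le> a i k" "a i k < K - real m"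
      proof -
        obtain j where j: "j < Q" "a i k + 1 \<le> a (Suc i) (Q * k + j)" using up by blast
        then have "P (a (Suc i) (Q * k + j))" using that step[OF j(1), of i k] by (auto simp: P_def)
        then show ?thesis using j member_le_sum[of j "{..<Q}" "\<lambda>j. of_bool (P (a (Suc i) (Q * k + j))) :: real"]
          by (auto simp: T_def)
      qed
      then have "of_bool (K - real (Suc m) \<le> a i k \<and> a i k \<le> K + R) \<le> of_bool (P (a i k)) + T"
        using T by (auto simp: P_def)
      then show "of_bool (K - real (Suc m) \<le> a i k \<and> a i k \<le> K + R)
        \<le> of_bool (P (a i k)) + real Q * ((\<Sum>j<Q. of_bool (P (a (Suc i) (Q * k + j)))) / real Q)"
        using Q_pos by (simp add: T_def)
    qed
    also have "\<dots> = f i + real Q * f (Suc i)"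
      unfolding avg_add avg_cmult f_def avg_Suc[OF Q_pos] P_def ..
    finally show ?thesis .
  qed
  have "(\<Sum>i<n. avg Q i (\<lambda>k. of_bool (K - real (Suc m) \<le> a i k \<and> a i k \<le> K + R)))
    \<le> (C * (1 + 2 * real Q)) * sqrt (real n)" for n
  proof (cases "n = 0")
    case False
    have "(\<Sum>i<n. avg Q i (\<lambda>k. of_bool (K - real (Suc m) \<le> a i k \<and> a i k \<le> K + R)))
      \<le> (\<Sum>i<n. f i + real Q * f (Suc i))"
      by (intro sum_mono le)
    also have "\<dots> = (\<Sum>i<n. f i) + real Q * (\<Sum>i<n. f (Suc i))"
      by (simp add: sum.distrib sum_distrib_left)
    also have "\<dots> \<le> (\<Sum>i<n. f i) + real Q * (\<Sum>i<Suc n. f i)"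
      using f_nonneg[of 0]
      by (intro add_left_mono mult_left_mono, subst sum.lessThan_Suc_shift) auto
    also have "\<dots> \<le> C * sqrt (real n) + real Q * (C * sqrt (real (Suc n)))"
      by (intro add_mono mult_left_mono C) auto
    also have "\<dots> \<le> C * sqrt (real n) + real Q * (C * (2 * sqrt (real n)))"
      using False C(1) by (intro add_left_mono mult_left_mono real_le_lsqrt) auto
    also have "\<dots> = (C * (1 + 2 * real Q)) * sqrt (real n)" by (simp add: algebra_simps)
    finally show ?thesis .
  qed simp
  then show ?case using C(1) by (intro exI[of _ "C * (1 + 2 * real Q)"]) auto
qed

lemma visits_le:
  "\<exists>C\<ge>0. \<forall>n. (\<Sum>i<n. avg Q i (\<lambda>k. of_bool (\<bar>a i k\<bar> \<le> B))) \<le> C * sqrt (real n)"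
proof -
  \<comment> \<open>\<open>2 * exp 1 * c\<close> turns \<open>K \<le> exp K\<close> into the
    smallness condition on \<open>c * exp (- K)\<close>. The entry \<open>\<bar>B\<bar>\<close> puts
    the window high enough, and the shift by \<open>m\<close> brings its bottom below
    \<open>- \<bar>B\<bar>\<close>.\<close>
  define K where "K = max (\<bar>B\<bar>) (2 * exp 1 * c)"
  have K0: "0 \<le> K" by (simp add: K_def)
  have "c \<le> K * exp (- 1) / 2" by (simp add: K_def exp_minus field_simps)
  also have "\<dots> \<le> exp K * exp (- 1) / 2"
    using exp_ge_add_one_self[of K] by (intro divide_right_mono mult_right_mono) (linarith | simp)+
  finally have K1: "c * exp (- K) \<le> exp (- 1) / 2" by (simp add: exp_minus field_simps)
  obtain m where m: "K + \<bar>B\<bar> \<le> real m" using real_arch_simple by blast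
  obtain C where C: "0 \<le> C"
    "\<And>n. (\<Sum>i<n. avg Q i (\<lambda>k. of_bool (K - real m \<le> a i k \<and> a i k \<le> K + R))) \<le> C * sqrt (real n)"
    using visits_shift[OF K0 K1, of m] by blast
  have "\<bar>B\<bar> \<le> K" by (simp add: K_def)
  have "(\<Sum>i<n. avg Q i (\<lambda>k. of_bool (\<bar>a i k\<bar> \<le> B))) \<le> 
    (\<Sum>i<n. avg Q i (\<lambda>k. of_bool (K - real m \<le> a i k \<and> a i k \<le> K + R)))" for n
    using m R_ge_1 \<open>\<bar>B\<bar> \<le> K\<close> by (intro sum_mono avg_mono) auto
  then show ?thesis using C order_trans by blast
qed

end

section \<open>Almost sure statements on the unit interval\<close>

text \<open>For \<open>y\<close> in [0, 1) this is the node of level \<open>n\<close> whose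
  \<open>Q\<close>-adic interval contains \<open>y\<close>. At \<open>y = 1\<close> the index would
  be \<open>Q ^ n\<close>, outside the tree, which is why later statements use
  \<open>{0..<1}\<close>.\<close>

definition cell :: "nat \<Rightarrow> nat \<Rightarrow> real \<Rightarrow> nat" where
  "cell Q n y = nat \<lfloor>real (Q ^ n) * y\<rfloor>"

lemma cell_measurable [measurable]: "cell Q n \<in> borel \<rightarrow>\<^sub>M count_space UNIV"
  unfolding cell_def by measurable

lemma cell_div:
  assumes "0 < Q" "i \<le> n" "0 \<le> y"
  shows "cell Q n y div Q ^ (n - i) = cell Q i y"
proof -
  have "real (Q ^ i) * y = real (Q ^ n) * y / real_of_int (int (Q ^ (n - i)))"
    using assms by (simp add: field_simps flip: power_add)
  then have "\<lfloor>real (Q ^ i) * y\<rfloor> = \<lfloor>real (Q ^ n) * y\<rfloor> div int (Q ^ (n - i))"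
    using floor_divide_real_eq_div[of "int (Q ^ (n - i))" "real (Q ^ n) * y"] by simp
  then show ?thesis
    using assms by (simp add: cell_def nat_div_distrib' nat_power_eq)
qed

text \<open>Each node of level \<open>n\<close> stands for an interval of length
  \<open>1 / Q ^ n\<close>, so fractions of nodes turn into Lebesgue measures.\<close>

lemma emeasure_cell_le:
  assumes "0 < Q"
  shows "emeasure lborel {y \<in> {0..<1}. P (cell Q n y)} \<le> ennreal (avg Q n (\<lambda>k. of_bool (P k)))"
proof -
  define q where "q = real (Q ^ n)"
  have q: "0 < q" using assms by (simp add: q_def)
  define A where "A = {k \<in> {..<Q ^ n}. P k}"
  have "{y \<in> {0..<1}. P (cell Q n y)} \<subseteq> (\<Union>k\<in>A. {real k / q..<(real k + 1) / q})"
  proof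
    fix y assume y: "y \<in> {y \<in> {0..<1}. P (cell Q n y)}"
    have fl: "real (cell Q n y) \<le> q * y" "q * y < real (cell Q n y) + 1"
      using y q by (auto simp: cell_def q_def)
    moreover have "q * y < q * 1" using y q by (intro mult_strict_left_mono) auto
    ultimately have "real (cell Q n y) < q" by linarith
    then have "cell Q n y < Q ^ n" by (simp add: q_def del: of_nat_power)
    then have "cell Q n y \<in> A" using y by (simp add: A_def)
    moreover have "y \<in> {real (cell Q n y) / q..<(real (cell Q n y) + 1) / q}"
      using fl q by (simp add: field_simps)
    ultimately show "y \<in> (\<Union>k\<in>A. {real k / q..<(real k + 1) / q})" by blast
  qed
  then have "emeasure lborel {y \<in> {0..<1}. P (cell Q n y)}
      \<le> emeasure lborel (\<Union>k\<in>A. {real k / q..<(real k + 1) / q})"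
    by (intro emeasure_mono) auto
  also have "\<dots> \<le> (\<Sum>k\<in>A. emeasure lborel {real k / q..<(real k + 1) / q})"
    by (intro emeasure_subadditive_finite) (auto simp: A_def)
  also have "\<dots> = (\<Sum>k\<in>A. ennreal (1 / q))"
    using q by (intro sum.cong refl) (simp add: divide_right_mono diff_divide_distrib[symmetric])
  also have "\<dots> = ennreal (\<Sum>k\<in>A. 1 / q)" using q by (intro sum_ennreal) auto
  also have "(\<Sum>k\<in>A. 1 / q) = avg Q n (\<lambda>k. of_bool (P k))"
    by (simp add: avg_def A_def q_def Int_def)
  finally show ?thesis .
qed

text \<open>A density of order \<open>1 / sqrt n\<close> is summable along powers of two, but not
  along all \<open>n\<close>. Monotonicity fills the gaps: for
  \<open>2 ^ k \<le> n < 2 ^ (k + 1)\<close> the average at \<open>n\<close> is at most twice that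
  at \<open>2 ^ (k + 1)\<close>.\<close>

lemma tendsto_average_0_from_powers:
  fixes Z :: "nat \<Rightarrow> real"
  assumes mono: "mono Z" and nonneg: "\<And>n. 0 \<le> Z n"
    and lim: "(\<lambda>k. Z (2 ^ k) / 2 ^ k) \<longlonglongrightarrow> 0"
  shows "(\<lambda>n. Z n / real n) \<longlonglongrightarrow> 0"
proof (rule LIMSEQ_I)
  fix r :: real assume r: "0 < r"
  then have "eventually (\<lambda>k. Z (2 ^ k) / 2 ^ k < r / 2) sequentially"
    using order_tendstoD(2)[OF lim, of "r / 2"] by simp
  then obtain k0 where k0: "\<And>k. k0 \<le> k \<Longrightarrow> Z (2 ^ k) / 2 ^ k < r / 2"
    by (auto simp: eventually_sequentially)
  have "norm (Z n / real n - 0) < r" if n: "2 ^ k0 \<le> n" for n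
  proof -
    have "1 \<le> n" using n by (meson one_le_numeral one_le_power order_trans)
    then obtain k where k: "2 ^ k \<le> n" "n < 2 ^ (k + 1)"
      using ex_power_ivl1[of 2 n] by auto
    have "(2::nat) ^ k0 < 2 ^ (k + 1)" using n k(2) by linarith
    then have "k0 \<le> k + 1" using power_strict_increasing_iff[of "2::nat" k0 "k + 1"] by simp
    have k1: "(2::real) ^ k \<le> real n" using k(1) by (metis of_nat_le_iff of_nat_numeral of_nat_power)
    have "Z n / real n \<le> Z (2 ^ (k + 1)) / 2 ^ k"
      using k k1 nonneg by (intro frac_le monoD[OF mono]) auto
    also have "\<dots> = 2 * (Z (2 ^ (k + 1)) / 2 ^ (k + 1))" by simp
    also have "\<dots> < r" using k0[OF \<open>k0 \<le> k + 1\<close>] by simp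
    finally show ?thesis using nonneg[of n] by simp
  qed
  then show "\<exists>no. \<forall>n\<ge>no. norm (Z n / real n - 0) < r" by blast
qed

section \<open>Behaviour of almost every branch of the tree\<close>

context drift_tree
begin

lemma cell_step:
  assumes "0 \<le> y"
  shows "\<bar>a (Suc n) (cell Q (Suc n) y) - a n (cell Q n y)\<bar> \<le> R"
proof -
  have "cell Q (Suc n) y = Q * cell Q n y + cell Q (Suc n) y mod Q"
    using cell_div[OF Q_pos le_SucI[OF order_refl[of n]] assms] mult_div_mod_eq[of Q "cell Q (Suc n) y"]
    by simp
  then show ?thesis using step[of "cell Q (Suc n) y mod Q" n "cell Q n y"] Q_pos by simp
qed

text \<open>Points that stay above \<open>K\<close> from level \<open>n0\<close> on lie, for every
  \<open>n\<close>, in surviving cells of level \<open>n\<close>, whose total measure tends to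
  0.\<close>

lemma AE_returns_below:
  assumes K: "R + 1 \<le> K" "\<And>t. K \<le> t \<Longrightarrow> c * exp (- t) * t \<le> 1 / 12"
  shows "AE y in lborel. y \<in> {0..<1} \<longrightarrow> (\<exists>i\<ge>n0. a i (cell Q i y) \<le> K)"
proof -
  define N where "N = {y \<in> {0..<1}. \<forall>i\<ge>n0. K < a i (cell Q i y)}"
  have N: "N \<in> sets lborel" unfolding N_def by measurable
  have "emeasure lborel N \<le> ennreal (avg Q n (\<lambda>k. of_bool (alive K n0 n k)))" for n
  proof -
    have "N \<subseteq> {y \<in> {0..<1}. alive K n0 n (cell Q n y)}"
      by (auto simp: N_def alive_def cell_div[OF Q_pos])
    then have "emeasure lborel N \<le> emeasure lborel {y \<in> {0..<1}. alive K n0 n (cell Q n y)}"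
      by (rule emeasure_mono) simp
    also have "\<dots> \<le> ennreal (avg Q n (\<lambda>k. of_bool (alive K n0 n k)))"
      by (rule emeasure_cell_le[OF Q_pos])
    finally show ?thesis .
  qed
  moreover have "(\<lambda>n. ennreal (avg Q n (\<lambda>k. of_bool (alive K n0 n k)))) \<longlonglongrightarrow> ennreal 0"
    by (intro tendsto_ennrealI alive_tendsto_0 K)
  ultimately have "emeasure lborel N \<le> ennreal 0"
    by (intro LIMSEQ_le_const) auto
  then have "N \<in> null_sets lborel" using N by (auto simp: null_sets_def)
  then show ?thesis by (rule AE_I') (use not_le in \<open>fastforce simp: N_def\<close>)
qed

text \<open>Visits below \<open>K\<close> and, by \<open>reflect\<close>, above \<open>- K\<close>
  recur forever. Steps are at most \<open>R < K\<close> and cannot jump over the interval between,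
  so avoiding it from some time on would confine the path to one side.\<close>

lemma AE_recurrent:
  assumes K: "R + 1 \<le> K" "\<And>t. K \<le> t \<Longrightarrow> c * exp (- t) * t \<le> 1 / 12"
  shows "AE y in lborel. y \<in> {0..<1} \<longrightarrow> infinite {n. \<bar>a n (cell Q n y)\<bar> \<le> K}"
proof -
  interpret neg: drift_tree Q "\<lambda>n k. - a n k" R c by (rule reflect)
  have "AE y in lborel. \<forall>n0. y \<in> {0..<1} \<longrightarrow> (\<exists>i\<ge>n0. a i (cell Q i y) \<le> K)"
    unfolding AE_all_countable by (intro allI AE_returns_below K)
  moreover have "AE y in lborel. \<forall>n0. y \<in> {0..<1} \<longrightarrow> (\<exists>i\<ge>n0. - a i (cell Q i y) \<le> K)"
    unfolding AE_all_countable by (intro allI neg.AE_returns_below K)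
  ultimately show ?thesis
  proof eventually_elim
    case (elim y)
    show ?case
    proof
      assume y: "y \<in> {0..<1}"
      define A where "A i = a i (cell Q i y)" for i
      have st: "\<bar>A (Suc i) - A i\<bar> \<le> R" for i using cell_step[of y i] y by (simp add: A_def)
      have "\<exists>n\<ge>n0. \<bar>A n\<bar> \<le> K" for n0
      proof (rule ccontr)
        assume "\<not> (\<exists>n\<ge>n0. \<bar>A n\<bar> \<le> K)"
        then have far: "K < \<bar>A n\<bar>" if "n0 \<le> n" for n using that by force
        have same: "(K < A (n0 + m)) \<longleftrightarrow> (K < A n0)" for m
        proof (induction m)
          case (Suc m)
          have "(K < A (Suc (n0 + m))) \<longleftrightarrow> (K < A (n0 + m))"
            using far[of "n0 + m"] far[of "Suc (n0 + m)"] st[of "n0 + m"] K(1) R_ge_1 by auto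
          then show ?case using Suc by simp
        qed simp
        obtain i where i: "n0 \<le> i" "A i \<le> K" using elim(1) y unfolding A_def by blast
        obtain j where j: "n0 \<le> j" "- A j \<le> K" using elim(2) y unfolding A_def by blast
        have "A (n0 + (i - n0)) \<le> K" "K < A (n0 + (j - n0))"
          using i j far[OF j(1)] by auto
        then show False using same[of "i - n0"] same[of "j - n0"] by simp
      qed
      then show "infinite {n. \<bar>a n (cell Q n y)\<bar> \<le> K}"
        unfolding A_def infinite_nat_iff_unbounded_le by simp
    qed
  qed
qed

text \<open>The averages \<open>z k\<close> up to time \<open>2 ^ k\<close> have integrals at most
  \<open>C * (1 / sqrt 2) ^ k\<close>. Their sum is integrable, hence finite almost everywhere, and
  there its terms tend to 0.\<close>

lemma AE_zero_density:
  "AE y in lborel. y \<in> {0..<1} \<longrightarrow>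
    (\<lambda>n. (\<Sum>i<n. of_bool (\<bar>a i (cell Q i y)\<bar> \<le> B)) / real n) \<longlonglongrightarrow> 0"
proof -
  obtain C where C: "0 \<le> C"
    "\<And>n. (\<Sum>i<n. avg Q i (\<lambda>k. of_bool (\<bar>a i k\<bar> \<le> B))) \<le> C * sqrt (real n)"
    using visits_le[of B] by blast
  define h where "h i y = (indicator {y \<in> {0..<1}. \<bar>a i (cell Q i y)\<bar> \<le> B} y :: real)" for i y
  define z where "z k y = (\<Sum>i<2 ^ k. h i y) / 2 ^ k" for k y
  have h_meas [measurable]: "h i \<in> borel_measurable lborel" for i
    unfolding h_def by measurable
  have z_meas [measurable]: "z k \<in> borel_measurable lborel" for k
    unfolding z_def by measurable
  have h_nonneg: "0 \<le> h i y" for i y by (simp add: h_def)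
  have z_nonneg: "0 \<le> z k y" for k y by (simp add: z_def sum_nonneg h_nonneg)
  have h_int: "(\<integral>\<^sup>+ y. ennreal (h i y) \<partial>lborel) \<le> ennreal (avg Q i (\<lambda>k. of_bool (\<bar>a i k\<bar> \<le> B)))" for i
  proof -
    have "(\<integral>\<^sup>+ y. ennreal (h i y) \<partial>lborel) = emeasure lborel {y \<in> {0..<1}. \<bar>a i (cell Q i y)\<bar> \<le> B}"
      unfolding h_def by (subst ennreal_indicator, subst nn_integral_indicator) measurable
    then show ?thesis using emeasure_cell_le[OF Q_pos, of "\<lambda>k. \<bar>a i k\<bar> \<le> B" i] by simp
  qed
  have z_int: "(\<integral>\<^sup>+ y. ennreal (z k y) \<partial>lborel) \<le> ennreal (C * (1 / sqrt 2) ^ k)" for k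
  proof -
    have "(\<integral>\<^sup>+ y. ennreal (z k y) \<partial>lborel) = (\<integral>\<^sup>+ y. ennreal (1 / 2 ^ k) * (\<Sum>i<2 ^ k. ennreal (h i y)) \<partial>lborel)"
      by (intro nn_integral_cong) (simp add: z_def sum_ennreal h_nonneg sum_nonneg flip: ennreal_mult)
    also have "\<dots> = ennreal (1 / 2 ^ k) * (\<integral>\<^sup>+ y. (\<Sum>i<2 ^ k. ennreal (h i y)) \<partial>lborel)"
      by (intro nn_integral_cmult) measurable
    also have "(\<integral>\<^sup>+ y. (\<Sum>i<2 ^ k. ennreal (h i y)) \<partial>lborel) = (\<Sum>i<2 ^ k. \<integral>\<^sup>+ y. ennreal (h i y) \<partial>lborel)"
      by (intro nn_integral_sum) measurable
    also have "ennreal (1 / 2 ^ k) * \<dots> \<le> ennreal (1 / 2 ^ k) *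
        (\<Sum>i<2 ^ k. ennreal (avg Q i (\<lambda>k. of_bool (\<bar>a i k\<bar> \<le> B))))"
      by (intro mult_left_mono sum_mono h_int) auto
    also have "\<dots> = ennreal (1 / 2 ^ k * (\<Sum>i<2 ^ k. avg Q i (\<lambda>k. of_bool (\<bar>a i k\<bar> \<le> B))))"
      by (simp add: sum_ennreal avg_nonneg sum_nonneg flip: ennreal_mult)
    also have "\<dots> \<le> ennreal (1 / 2 ^ k * (C * sqrt (real (2 ^ k))))"
      by (intro ennreal_leI mult_left_mono C) auto
    also have "1 / 2 ^ k * (C * sqrt (real (2 ^ k))) = C * (1 / sqrt 2) ^ k"
      by (simp add: real_sqrt_power power_divide field_simps flip: power_mult_distrib)
    finally show ?thesis .
  qed
  have sm: "summable (\<lambda>k. C * (1 / sqrt 2) ^ k)"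
    by (intro summable_mult summable_geometric) simp
  have "(\<integral>\<^sup>+ y. (\<Sum>k. ennreal (z k y)) \<partial>lborel) = (\<Sum>k. \<integral>\<^sup>+ y. ennreal (z k y) \<partial>lborel)"
    by (intro nn_integral_suminf) measurable
  also have "\<dots> \<le> (\<Sum>k. ennreal (C * (1 / sqrt 2) ^ k))"
    by (intro suminf_le z_int) auto
  also have "\<dots> = ennreal (\<Sum>k. C * (1 / sqrt 2) ^ k)"
    using C sm by (intro suminf_ennreal2) auto
  also have "\<dots> < \<infinity>" by simp
  finally have "(\<integral>\<^sup>+ y. (\<Sum>k. ennreal (z k y)) \<partial>lborel) \<noteq> \<infinity>" by simp
  then have "AE y in lborel. (\<Sum>k. ennreal (z k y)) \<noteq> \<infinity>"
    by (intro nn_integral_PInf_AE) measurable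
  then show ?thesis
  proof eventually_elim
    case (elim y)
    show ?case
    proof
      assume y: "y \<in> {0..<1}"
      have "summable (\<lambda>k. z k y)"
        using elim z_nonneg by (intro summable_suminf_not_top) auto
      then have "(\<lambda>k. z k y) \<longlonglongrightarrow> 0" by (rule summable_LIMSEQ_zero)
      then have "(\<lambda>n. (\<Sum>i<n. h i y) / real n) \<longlonglongrightarrow> 0"
        unfolding z_def by (intro tendsto_average_0_from_powers)
          (auto simp: sum_nonneg h_nonneg intro!: monoI sum_mono2)
      then show "(\<lambda>n. (\<Sum>i<n. of_bool (\<bar>a i (cell Q i y)\<bar> \<le> B)) / real n) \<longlonglongrightarrow> 0"
        using y by (simp add: h_def indicator_def of_bool_def)
    qed
  qed
qed

end

section \<open>Fibre maps in the logit coordinate\<close>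

text \<open>Invariance of Lebesgue measure under \<open>E2\<close>: the arguments of
  \<open>F\<close> on the left are the two inverse branches.\<close>

lemma halves_integral:
  fixes F :: "real \<Rightarrow> real"
  assumes "continuous_on {0..1} F"
  shows "integral {0..1} (\<lambda>s. F (s / 2)) + integral {0..1} (\<lambda>s. F ((1 + s) / 2)) = 2 * integral {0..1} F"
proof -
  have int: "F integrable_on {u..v}" if "0 \<le> u" "v \<le> 1" for u v
    using that by (intro integrable_continuous_real continuous_on_subset[OF assms]) auto
  have 1: "integral {0..1} (\<lambda>s. F (s / 2)) = 2 * integral {0..1 / 2} F"
    using has_integral_affinity'[OF integrable_integral[OF int[of 0 "1 / 2"], folded box_real], of "1 / 2" 0]
    by (simp add: integral_unique)
  have 2: "integral {0..1} (\<lambda>s. F ((1 + s) / 2)) = 2 * integral {1 / 2..1} F"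
    using has_integral_affinity'[OF integrable_integral[OF int[of "1 / 2" 1], folded box_real], of "1 / 2" "1 / 2"]
    by (simp add: integral_unique add_divide_distrib add.commute)
  have "integral {0..1 / 2} F + integral {1 / 2..1} F = integral {0..1} F"
    by (intro Henstock_Kurzweil_Integration.integral_combine int) auto
  then show ?thesis using 1 2 by simp
qed

lemma integral_close_to_value:
  fixes f :: "real \<Rightarrow> real"
  assumes "continuous_on {0..1} f" "\<And>s. s \<in> {0..1} \<Longrightarrow> \<bar>f s - z\<bar> \<le> B"
  shows "\<bar>integral {0..1} f - z\<bar> \<le> B"
proof -
  have "integral {0..1} f - z = integral {0..1} (\<lambda>s. f s - z)"
    using integrable_continuous_real[OF assms(1)]
    by (subst Henstock_Kurzweil_Integration.integral_diff) auto
  moreover have "norm (integral {0..1} (\<lambda>s. f s - z)) \<le> B * (1 - 0)"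
    using assms by (intro integral_bound continuous_intros) auto
  ultimately show ?thesis by simp
qed

lemma cell_0: "y \<in> {0..<1} \<Longrightarrow> cell 2 0 y = 0"
  by (simp add: cell_def)

lemma E2_iterate_cell:
  assumes y: "y \<in> {0..<1}"
  shows "(E2 ^^ i) y \<in> {0..<1} \<and> real (cell 2 i y) + (E2 ^^ i) y = 2 ^ i * y"
proof (induction i)
  case 0
  then show ?case using y by (simp add: cell_0)
next
  case (Suc i)
  define t where "t = (E2 ^^ i) y"
  have t: "0 \<le> t" "t < 1" "2 ^ i * y = real (cell 2 i y) + t" using Suc by (auto simp: t_def)
  have "2 ^ Suc i * y = of_int (2 * int (cell 2 i y)) + 2 * t" using t(3) by simp
  then have "\<lfloor>2 ^ Suc i * y\<rfloor> = 2 * int (cell 2 i y) + \<lfloor>2 * t\<rfloor>"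
    by (simp only: int_add_floor)
  moreover have "0 \<le> \<lfloor>2 * t\<rfloor>" using t(1) by simp
  moreover have "cell 2 (Suc i) y = nat \<lfloor>2 ^ Suc i * y\<rfloor>" by (simp add: cell_def)
  ultimately have "real (cell 2 (Suc i) y) = 2 * real (cell 2 i y) + of_int \<lfloor>2 * t\<rfloor>"
    by (simp only: of_nat_nat add_nonneg_nonneg mult_nonneg_nonneg zero_le_numeral of_nat_0_le_iff)
  moreover have "(E2 ^^ Suc i) y = 2 * t - of_int \<lfloor>2 * t\<rfloor>" by (simp add: t_def E2_def)
  moreover have "2 ^ Suc i * y = 2 * (real (cell 2 i y) + t)" using t(3) by simp
  moreover have "2 * t - of_int \<lfloor>2 * t\<rfloor> \<in> {0..<1}" by (simp, linarith)
  ultimately show ?case by (simp only:) (simp add: algebra_simps)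
qed

text \<open>The last binary digit of \<open>cell 2 (Suc i) y\<close> selects the inverse branch that
  leads back from \<open>(E2 ^^ Suc i) y\<close> to \<open>(E2 ^^ i) y\<close>; this is the
  recursion by which curves are defined below.\<close>

lemma E2_preimage:
  assumes "y \<in> {0..<1}"
  shows "cell 2 (Suc i) y div 2 = cell 2 i y"
    and "(real (cell 2 (Suc i) y mod 2) + (E2 ^^ Suc i) y) / 2 = (E2 ^^ i) y"
proof -
  show *: "cell 2 (Suc i) y div 2 = cell 2 i y"
    using cell_div[of 2 i "Suc i" y] assms by simp
  have "real (cell 2 (Suc i) y) = 2 * real (cell 2 i y) + real (cell 2 (Suc i) y mod 2)"
    using * mult_div_mod_eq[of 2 "cell 2 (Suc i) y"] by (metis of_nat_add of_nat_mult of_nat_numeral)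
  then show "(real (cell 2 (Suc i) y mod 2) + (E2 ^^ Suc i) y) / 2 = (E2 ^^ i) y"
    using E2_iterate_cell[OF assms, of i] E2_iterate_cell[OF assms, of "Suc i"]
    by (simp del: funpow.simps)
qed

lemma sum_lessThan_double: "(\<Sum>j<2 * n. f j) = (\<Sum>j<n. f (2 * j) + f (2 * j + 1))"
  for n :: nat and f :: "nat \<Rightarrow> 'a::comm_monoid_add"
  by (induction n) (auto simp: ac_simps)

lemma sum_div_le:
  fixes f :: "nat \<Rightarrow> real"
  assumes "0 < N" "\<And>i. 0 \<le> f i"
  shows "(\<Sum>i<n. f (i div N)) \<le> real N * (\<Sum>i<n. f i)"
proof -
  have "(\<Sum>i<n. f (i div N)) \<le> (\<Sum>i<n * N. f (i div N))"
    using assms by (intro sum_mono2) auto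
  also have "\<dots> = (\<Sum>j<n. \<Sum>i\<in>{j * N..<j * N + N}. f (i div N))"
    by (simp add: sum.nat_group)
  also have "\<dots> = (\<Sum>j<n. \<Sum>i\<in>{j * N..<j * N + N}. f j)"
  proof (intro sum.cong refl)
    fix j i assume "i \<in> {j * N..<j * N + N}"
    then have "i div N = j" by (intro div_nat_eqI) (auto simp: mult.commute)
    then show "f (i div N) = f j" by simp
  qed
  also have "\<dots> = real N * (\<Sum>i<n. f i)" by (simp add: sum_distrib_left)
  finally show ?thesis .
qed

text \<open>\<open>\<zeta>0\<close> and \<open>\<zeta>1\<close> are the asymptotic displacements at
  minus and plus infinity; neutrality means that both have mean zero. The two alternatives in
  \<open>ends\<close> correspond to increasing and decreasing \<open>\<xi>\<close>.\<close>

locale neutral_fibre =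
  fixes \<phi> :: "real \<Rightarrow> real \<Rightarrow> real" and \<zeta>0 \<zeta>1 :: "real \<Rightarrow> real" and L c X b :: real
  assumes L_nonneg: "0 \<le> L" and c_nonneg: "0 \<le> c"
    and Lip: "\<lbrakk>y \<in> {0..1}; y' \<in> {0..1}\<rbrakk> \<Longrightarrow> \<bar>\<phi> y u - \<phi> y' u'\<bar> \<le> 3 / 2 * \<bar>u - u'\<bar> + L * \<bar>y - y'\<bar>"
    and left: "y \<in> {0..1} \<Longrightarrow> \<bar>\<phi> y u - u - \<zeta>0 y\<bar> \<le> c * exp u"
    and right: "y \<in> {0..1} \<Longrightarrow> \<bar>\<phi> y u - u - \<zeta>1 y\<bar> \<le> c * exp (- u)"
    and \<zeta>0: "(\<zeta>0 has_integral 0) {0..1}" and \<zeta>1: "(\<zeta>1 has_integral 0) {0..1}"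
    and increment: "y \<in> {0..1} \<Longrightarrow> \<bar>\<phi> y u - u\<bar> \<le> X"
    and b_pos: "0 < b"
    and ends: "(\<forall>u. \<phi> 0 u \<le> u - b) \<and> (\<forall>u. u + b \<le> \<phi> 1 u) \<or>
      (\<forall>u. \<phi> 1 u \<le> u - b) \<and> (\<forall>u. u + b \<le> \<phi> 0 u)"
begin

text \<open>\<open>curve u0 i k\<close> is the image of \<open>u0\<close> after \<open>i\<close> steps over the \<open>k\<close>-th dyadic interval of level \<open>i\<close>,
  as a function of the base point \<open>s = (E2 ^^ i) y\<close> reached; \<open>(real (k mod 2) + s) / 2\<close> is the
  preimage of \<open>s\<close> under the branch taken last.\<close>

primrec curve :: "real \<Rightarrow> nat \<Rightarrow> nat \<Rightarrow> real \<Rightarrow> real" where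
  "curve u0 0 k s = u0"
| "curve u0 (Suc i) k s =
    \<phi> ((real (k mod 2) + s) / 2) (curve u0 i (k div 2) ((real (k mod 2) + s) / 2))"

primrec orbit :: "real \<Rightarrow> real \<Rightarrow> nat \<Rightarrow> real" where
  "orbit u0 y 0 = u0"
| "orbit u0 y (Suc i) = \<phi> ((E2 ^^ i) y) (orbit u0 y i)"

lemma preimage_in: "s \<in> {0..1} \<Longrightarrow> (real (k mod 2) + s) / 2 \<in> {0..1}"
  by (cases "even k") (auto simp: odd_iff_mod_2_eq_one even_iff_mod_2_eq_zero)

text \<open>An inverse branch halves base distances, so a Lipschitz constant \<open>K\<close> turns
  into \<open>(3 / 2 * K + L) / 2\<close>; \<open>2 * L\<close> is the fixed point of this
  map.\<close>

lemma curve_Lipschitz: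
  "\<lbrakk>s \<in> {0..1}; t \<in> {0..1}\<rbrakk> \<Longrightarrow> \<bar>curve u0 i k s - curve u0 i k t\<bar> \<le> 2 * L * \<bar>s - t\<bar>"
proof (induction i arbitrary: k s t)
  case 0
  then show ?case using L_nonneg by simp
next
  case (Suc i)
  define s' t' where "s' = (real (k mod 2) + s) / 2" and "t' = (real (k mod 2) + t) / 2"
  have in01: "s' \<in> {0..1}" "t' \<in> {0..1}"
    unfolding s'_def t'_def by (intro preimage_in Suc.prems)+
  have "s' - t' = (s - t) / 2" by (simp add: s'_def t'_def diff_divide_distrib add_divide_distrib)
  then have half: "\<bar>s' - t'\<bar> = \<bar>s - t\<bar> / 2" by (simp only: abs_divide abs_numeral)
  have "\<bar>curve u0 (Suc i) k s - curve u0 (Suc i) k t\<bar>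
      \<le> 3 / 2 * \<bar>curve u0 i (k div 2) s' - curve u0 i (k div 2) t'\<bar> + L * \<bar>s' - t'\<bar>"
    unfolding curve.simps s'_def[symmetric] t'_def[symmetric] by (rule Lip[OF in01])
  also have "\<dots> \<le> 3 / 2 * (2 * L * \<bar>s' - t'\<bar>) + L * \<bar>s' - t'\<bar>"
    by (intro add_right_mono mult_left_mono Suc.IH[OF in01]) simp
  also have "\<dots> = 2 * L * \<bar>s - t\<bar>" by (simp add: half)
  finally show ?case .
qed

lemma curve_continuous: "continuous_on {0..1} (curve u0 i k)"
proof -
  have "(2 * L)-lipschitz_on {0..1} (curve u0 i k)"
    using curve_Lipschitz L_nonneg by (intro lipschitz_onI) (auto simp: dist_real_def)
  then show ?thesis by (rule lipschitz_on_continuous_on)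
qed

lemma curve_image_continuous: "continuous_on {0..1} (\<lambda>s. \<phi> s (curve u0 i k s))"
proof -
  have "(4 * L)-lipschitz_on {0..1} (\<lambda>s. \<phi> s (curve u0 i k s))"
  proof (rule lipschitz_onI)
    fix s t :: real assume st: "s \<in> {0..1}" "t \<in> {0..1}"
    have "\<bar>\<phi> s (curve u0 i k s) - \<phi> t (curve u0 i k t)\<bar>
        \<le> 3 / 2 * \<bar>curve u0 i k s - curve u0 i k t\<bar> + L * \<bar>s - t\<bar>" by (rule Lip[OF st])
    also have "\<dots> \<le> 3 / 2 * (2 * L * \<bar>s - t\<bar>) + L * \<bar>s - t\<bar>" 
      by (intro add_right_mono mult_left_mono curve_Lipschitz[OF st]) simp
    finally show "dist (\<phi> s (curve u0 i k s)) (\<phi> t (curve u0 i k t)) \<le> 4 * L * dist s t"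
      by (simp add: dist_real_def)
  qed (use L_nonneg in simp)
  then show ?thesis by (rule lipschitz_on_continuous_on)
qed

section \<open>The mean of a curve as a process on the dyadic tree\<close>

definition mean :: "real \<Rightarrow> nat \<Rightarrow> nat \<Rightarrow> real" where
  "mean u0 i k = integral {0..1} (curve u0 i k)"

lemma curve_close_mean:
  assumes "s \<in> {0..1}"
  shows "\<bar>curve u0 i k s - mean u0 i k\<bar> \<le> 2 * L"
proof -
  have "\<bar>integral {0..1} (curve u0 i k) - curve u0 i k s\<bar> \<le> 2 * L"
  proof (intro integral_close_to_value curve_continuous)
    fix t :: real assume t: "t \<in> {0..1}"
    have "\<bar>curve u0 i k t - curve u0 i k s\<bar> \<le> 2 * L * \<bar>t - s\<bar>" by (rule curve_Lipschitz[OF t assms])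
    also have "\<dots> \<le> 2 * L * 1" using t assms L_nonneg by (intro mult_left_mono) auto
    finally show "\<bar>curve u0 i k t - curve u0 i k s\<bar> \<le> 2 * L" by simp
  qed
  then show ?thesis by (simp add: mean_def abs_minus_commute)
qed

lemma mean_step: "\<bar>mean u0 (Suc i) k - mean u0 i (k div 2)\<bar> \<le> X + 4 * L"
proof -
  define s' where "s' = (real (k mod 2) + 0) / 2"
  have s': "s' \<in> {0..1}" unfolding s'_def by (rule preimage_in) simp
  have "curve u0 (Suc i) k 0 = \<phi> s' (curve u0 i (k div 2) s')" by (simp add: s'_def)
  moreover have "\<bar>curve u0 (Suc i) k 0 - mean u0 (Suc i) k\<bar> \<le> 2 * L"
    by (rule curve_close_mean) simp
  ultimately show ?thesis
    using increment[OF s', of "curve u0 i (k div 2) s'"] curve_close_mean[OF s', of u0 i "k div 2"]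
    by linarith
qed

lemma mean_children:
  "mean u0 (Suc i) (2 * k) + mean u0 (Suc i) (2 * k + 1) = 2 * integral {0..1} (\<lambda>s. \<phi> s (curve u0 i k s))"
proof -
  have "curve u0 (Suc i) (2 * k) = (\<lambda>s. \<phi> (s / 2) (curve u0 i k (s / 2)))"
    and "curve u0 (Suc i) (2 * k + 1) = (\<lambda>s. \<phi> ((1 + s) / 2) (curve u0 i k ((1 + s) / 2)))"
    by auto
  then show ?thesis
    using halves_integral[OF curve_image_continuous, of u0 i k] by (simp only: mean_def)
qed

text \<open>Since \<open>\<zeta>0\<close> and \<open>\<zeta>1\<close> have integral zero, only the
  errors in \<open>left\<close> and \<open>right\<close> contribute, and the better of the two
  bounds is taken. The factor \<open>exp (2 * L)\<close> pays for replacing the curve by its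
  mean.\<close>

lemma mean_drift:
  "\<bar>mean u0 (Suc i) (2 * k) + mean u0 (Suc i) (2 * k + 1) - 2 * mean u0 i k\<bar>
    \<le> 2 * (c * exp (2 * L)) * exp (- \<bar>mean u0 i k\<bar>)"
proof -
  have *: "\<bar>integral {0..1} (\<lambda>s. \<phi> s (curve u0 i k s)) - mean u0 i k\<bar> \<le> B"
    if \<zeta>: "(\<zeta> has_integral 0) {0..1}"
      and B: "\<And>s. s \<in> {0..1} \<Longrightarrow> \<bar>\<phi> s (curve u0 i k s) - curve u0 i k s - \<zeta> s\<bar> \<le> B" for \<zeta> B
  proof -
    have "((\<lambda>s. \<phi> s (curve u0 i k s) - curve u0 i k s - \<zeta> s) has_integral
      (integral {0..1} (\<lambda>s. \<phi> s (curve u0 i k s)) - mean u0 i k - 0)) {0..1}"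
      unfolding mean_def
      by (intro has_integral_diff \<zeta> integrable_integral integrable_continuous_real
          curve_image_continuous curve_continuous)
    then have "norm (integral {0..1} (\<lambda>s. \<phi> s (curve u0 i k s)) - mean u0 i k - 0)
        \<le> B * measure lborel {0..1::real}"
      using order_trans[OF abs_ge_zero B[of 0]] B
      by (intro has_integral_bound_real[where S = "{}"]) auto
    then show ?thesis by simp
  qed
  have "\<bar>integral {0..1} (\<lambda>s. \<phi> s (curve u0 i k s)) - mean u0 i k\<bar> \<le> c * exp (mean u0 i k + 2 * L)"
  proof (rule *[OF \<zeta>0])
    fix s :: real assume s: "s \<in> {0..1}"
    have "c * exp (curve u0 i k s) \<le> c * exp (mean u0 i k + 2 * L)"
      using curve_close_mean[OF s, of u0 i k] c_nonneg by (intro mult_left_mono) auto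
    then show "\<bar>\<phi> s (curve u0 i k s) - curve u0 i k s - \<zeta>0 s\<bar> \<le> c * exp (mean u0 i k + 2 * L)"
      using left[OF s, of "curve u0 i k s"] by linarith
  qed
  moreover have "\<bar>integral {0..1} (\<lambda>s. \<phi> s (curve u0 i k s)) - mean u0 i k\<bar> \<le> c * exp (- mean u0 i k + 2 * L)"
  proof (rule *[OF \<zeta>1])
    fix s :: real assume s: "s \<in> {0..1}"
    have "c * exp (- curve u0 i k s) \<le> c * exp (- mean u0 i k + 2 * L)"
      using curve_close_mean[OF s, of u0 i k] c_nonneg by (intro mult_left_mono) auto
    then show "\<bar>\<phi> s (curve u0 i k s) - curve u0 i k s - \<zeta>1 s\<bar> \<le> c * exp (- mean u0 i k + 2 * L)"
      using right[OF s, of "curve u0 i k s"] by linarith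
  qed
  ultimately have "\<bar>integral {0..1} (\<lambda>s. \<phi> s (curve u0 i k s)) - mean u0 i k\<bar>
      \<le> c * exp (- \<bar>mean u0 i k\<bar> + 2 * L)"
    by (cases "0 \<le> mean u0 i k") auto
  also have "\<dots> = (c * exp (2 * L)) * exp (- \<bar>mean u0 i k\<bar>)"
    unfolding exp_add by (simp only: mult_ac)
  finally show ?thesis unfolding mean_children by linarith
qed

lemma mean_steps: "\<bar>mean u0 (i + m) k - mean u0 i (k div 2 ^ m)\<bar> \<le> real m * (X + 4 * L)"
proof (induction m arbitrary: k)
  case (Suc m)
  have "k div 2 ^ Suc m = (k div 2) div 2 ^ m" by (simp add: div_mult2_eq)
  then show ?case
    using Suc[of "k div 2"] mean_step[of u0 "i + m" k] by (simp add: algebra_simps)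
qed simp

lemma mean_steps_child:
  assumes "j < 2 ^ m"
  shows "\<bar>mean u0 (i + m) (2 ^ m * k + j) - mean u0 i k\<bar> \<le> real m * (X + 4 * L)"
  using mean_steps[of u0 i m "2 ^ m * k + j"] assms by simp

text \<open>The last generation is split off. Its drift involves the mean at a descendant, which is
  \<open>m\<close> steps away from the mean at the root; this costs the factor
  \<open>exp (real m * (X + 4 * L))\<close>.\<close>

lemma mean_steps_drift:
  "\<bar>\<Sum>j<2 ^ m. mean u0 (i + m) (2 ^ m * k + j) - mean u0 i k\<bar>
    \<le> 2 ^ m * real m * (c * exp (2 * L)) * exp (real m * (X + 4 * L)) * exp (- \<bar>mean u0 i k\<bar>)"
proof (induction m)
  case (Suc m)
  define r where "r = X + 4 * L"
  define c1 where "c1 = c * exp (2 * L)"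
  define e where "e = exp (- \<bar>mean u0 i k\<bar>)"
  have r: "0 \<le> r" using increment[of 0 0] L_nonneg by (simp add: r_def)
  have c1: "0 \<le> c1" using c_nonneg by (simp add: c1_def)
  define D where "D j = mean u0 (Suc (i + m)) (2 * (2 ^ m * k + j)) + mean u0 (Suc (i + m)) (2 * (2 ^ m * k + j) + 1)
    - 2 * mean u0 (i + m) (2 ^ m * k + j)" for j
  have D: "\<bar>D j\<bar> \<le> 2 * c1 * exp (real m * r) * e" if "j < 2 ^ m" for j
  proof -
    have "\<bar>D j\<bar> \<le> 2 * c1 * exp (- \<bar>mean u0 (i + m) (2 ^ m * k + j)\<bar>)"
      unfolding D_def c1_def by (rule mean_drift)
    also have "\<dots> \<le> 2 * c1 * exp (real m * r + - \<bar>mean u0 i k\<bar>)"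
      using mean_steps_child[OF that, of u0 i k] c1 by (intro mult_left_mono) (auto simp: r_def)
    finally show ?thesis by (simp add: e_def mult.assoc flip: exp_add)
  qed
  have "(\<Sum>j<2 ^ Suc m. mean u0 (i + Suc m) (2 ^ Suc m * k + j) - mean u0 i k)
    = (\<Sum>j<2 ^ m. D j) + 2 * (\<Sum>j<2 ^ m. mean u0 (i + m) (2 ^ m * k + j) - mean u0 i k)"
    unfolding power_Suc sum_lessThan_double sum_distrib_left sum.distrib[symmetric]
    by (intro sum.cong) (auto simp: D_def algebra_simps)
  also have "\<bar>\<dots>\<bar> \<le> (\<Sum>j<2 ^ m. \<bar>D j\<bar>) + 2 * \<bar>\<Sum>j<2 ^ m. mean u0 (i + m) (2 ^ m * k + j) - mean u0 i k\<bar>"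
    using sum_abs[of D "{..<2 ^ m}"] by linarith
  also have "\<dots> \<le> (\<Sum>j<(2::nat) ^ m. 2 * c1 * exp (real m * r) * e) + 2 * (2 ^ m * real m * c1 * exp (real m * r) * e)"
    using Suc D by (intro add_mono sum_mono mult_left_mono) (auto simp: r_def c1_def e_def)
  also have "\<dots> = 2 ^ Suc m * real (Suc m) * c1 * exp (real m * r) * e"
    by (simp add: algebra_simps)
  also have "\<dots> \<le> 2 ^ Suc m * real (Suc m) * c1 * exp (real (Suc m) * r) * e"
    using r c1 by (intro mult_right_mono mult_left_mono) (auto simp: e_def algebra_simps)
  finally show ?case by (simp only: r_def c1_def e_def)
qed simp

text \<open>The index appends \<open>m\<close> binary digits equal to \<open>d\<close>. The inverse
  branch with digit \<open>d\<close> fixes the base point \<open>d\<close>, so the curve at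
  \<open>s = d\<close> is moved by the same map \<open>\<phi> (real d)\<close> at each step;
  \<open>\<epsilon>\<close> is the direction of motion.\<close>

lemma end_child:
  assumes d: "d \<in> {0, 1::nat}" and \<epsilon>: "\<epsilon> \<in> {-1, 1::real}"
    and move: "\<And>u. b \<le> \<epsilon> * (\<phi> (real d) u - u)"
  shows "\<epsilon> * (mean u0 (i + m) (2 ^ m * k + d * (2 ^ m - 1)) - mean u0 i k) \<ge> real m * b - 4 * L"
proof -
  have curve: "\<epsilon> * (curve u0 (i + m) (2 ^ m * k + d * (2 ^ m - 1)) (real d) - curve u0 i k (real d)) \<ge> real m * b"
  proof (induction m)
    case (Suc m)
    have "2 ^ Suc m * k + d * (2 ^ Suc m - 1) = 2 * (2 ^ m * k + d * (2 ^ m - 1)) + d"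
    proof -
      obtain p where "(2::nat) ^ m = Suc p" using not0_implies_Suc[of "2 ^ m"] by auto
      then show ?thesis using d by auto
    qed
    moreover have "(2 * n + d) mod 2 = d" "(2 * n + d) div 2 = n" for n using d by auto
    ultimately have "curve u0 (i + Suc m) (2 ^ Suc m * k + d * (2 ^ Suc m - 1)) (real d)
        = \<phi> (real d) (curve u0 (i + m) (2 ^ m * k + d * (2 ^ m - 1)) (real d))"
      by (simp only: add_Suc_right curve.simps) simp
    then show ?case
      using Suc move[of "curve u0 (i + m) (2 ^ m * k + d * (2 ^ m - 1)) (real d)"]
      by (simp add: algebra_simps)
  qed simp
  have d01: "real d \<in> {0..1}" using d by auto
  show ?thesis
    using curve curve_close_mean[OF d01, of u0 "i + m" "2 ^ m * k + d * (2 ^ m - 1)"]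
      curve_close_mean[OF d01, of u0 i k] \<epsilon> by auto
qed

lemma end_child_index: "d \<in> {0, 1::nat} \<Longrightarrow> d * (2 ^ m - 1) < (2::nat) ^ m"
  by auto

text \<open>Passing to the mean of a curve costs at most \<open>2 * L\<close> at either end, so \<open>4 * L + 1\<close> is the
  displacement that moves the mean by 1.\<close>

definition block :: nat where
  "block = (LEAST N. 4 * L + 1 \<le> real N * b)"

lemma block: "4 * L + 1 \<le> real block * b"
proof -
  obtain N :: nat where "(4 * L + 1) / b \<le> real N" using real_arch_simple by blast
  then have "4 * L + 1 \<le> real N * b" using b_pos by (simp add: field_simps)
  then show ?thesis unfolding block_def by (rule LeastI)
qed

lemma block_pos: "0 < block"
  using block L_nonneg by (cases "block = 0") auto

definition block_jump :: real where "block_jump = real block * (X + 4 * L)"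

definition block_drift :: real where
  "block_drift = 2 ^ block * real block * (c * exp (2 * L)) * exp (real block * (X + 4 * L))"

lemma mean_tree: "drift_tree (2 ^ block) (\<lambda>n k. mean u0 (block * n) k) block_jump block_drift"
proof
  fix n k j :: nat
  have idx: "block * Suc n = block * n + block" by simp
  show "0 \<le> block_drift" using c_nonneg by (simp add: block_drift_def)
  show "\<bar>mean u0 (block * Suc n) (2 ^ block * k + j) - mean u0 (block * n) k\<bar> \<le> block_jump"
    if "j < 2 ^ block" unfolding idx block_jump_def by (rule mean_steps_child[OF that])
  show "\<bar>\<Sum>j<2 ^ block. mean u0 (block * Suc n) (2 ^ block * k + j) - mean u0 (block * n) k\<bar>
      \<le> block_drift * exp (- \<bar>mean u0 (block * n) k\<bar>)"
    unfolding idx block_drift_def by (rule mean_steps_drift)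
  have child: "\<exists>j<2 ^ block. 1 \<le> \<epsilon> * (mean u0 (block * Suc n) (2 ^ block * k + j) - mean u0 (block * n) k)"
    if "d \<in> {0, 1::nat}" "\<epsilon> \<in> {-1, 1}" "\<And>u. b \<le> \<epsilon> * (\<phi> (real d) u - u)" for d and \<epsilon> :: real
    unfolding idx
    using end_child[OF that, of block u0 "block * n" k] block end_child_index[OF that(1), of block]
    by (intro exI[of _ "d * (2 ^ block - 1)"]) auto
  have up_down: "(\<exists>d\<in>{0, 1::nat}. \<forall>u. b \<le> 1 * (\<phi> (real d) u - u)) \<and>
      (\<exists>d\<in>{0, 1::nat}. \<forall>u. b \<le> -1 * (\<phi> (real d) u - u))"
    using ends by (auto simp: algebra_simps)
  have "\<exists>j<2 ^ block. 1 \<le> 1 * (mean u0 (block * Suc n) (2 ^ block * k + j) - mean u0 (block * n) k)"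
    using up_down child[of _ 1] by blast
  then show "\<exists>j<2 ^ block. mean u0 (block * n) k + 1 \<le> mean u0 (block * Suc n) (2 ^ block * k + j)"
    by (auto simp: algebra_simps)
  have "\<exists>j<2 ^ block. 1 \<le> -1 * (mean u0 (block * Suc n) (2 ^ block * k + j) - mean u0 (block * n) k)"
    using up_down child[of _ "-1"] by blast
  then show "\<exists>j<2 ^ block. mean u0 (block * Suc n) (2 ^ block * k + j) \<le> mean u0 (block * n) k - 1"
    by (auto simp: algebra_simps)
qed simp

section \<open>Transfer from means at block times to orbits\<close>

lemma orbit_eq_curve:
  assumes y: "y \<in> {0..<1}"
  shows "orbit u0 y i = curve u0 i (cell 2 i y) ((E2 ^^ i) y)"
proof (induction i)
  case (Suc i)
  show ?case by (simp only: curve.simps E2_preimage[OF y] orbit.simps Suc)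
qed simp

lemma orbit_close_mean:
  assumes y: "y \<in> {0..<1}"
  shows "\<bar>orbit u0 y (block * n) - mean u0 (block * n) (cell (2 ^ block) n y)\<bar> \<le> 2 * L"
proof -
  have "cell (2 ^ block) n y = cell 2 (block * n) y" by (simp add: cell_def power_mult)
  then show ?thesis
    unfolding orbit_eq_curve[OF y] using E2_iterate_cell[OF y, of "block * n"]
    by (simp add: curve_close_mean)
qed

lemma orbit_steps:
  assumes y: "y \<in> {0..<1}"
  shows "\<bar>orbit u0 y (i + m) - orbit u0 y i\<bar> \<le> real m * X"
proof (induction m)
  case (Suc m)
  have "(E2 ^^ (i + m)) y \<in> {0..1}" using E2_iterate_cell[OF y, of "i + m"] by auto
  from increment[OF this, of "orbit u0 y (i + m)"] Suc show ?case by (simp add: algebra_simps)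
qed simp

text \<open>\<open>K\<close> is independent of \<open>u0\<close> because the constants of the tree
  are; in the end \<open>\<epsilon>0\<close> has to be chosen before \<open>x\<close>.\<close>

lemma orbit_recurrent:
  "\<exists>K. \<forall>u0. AE y in lborel. y \<in> {0..<1} \<longrightarrow> infinite {i. \<bar>orbit u0 y i\<bar> \<le> K}"
proof -
  \<comment> \<open>The first entry meets the step-size condition of \<open>AE_recurrent\<close>.
    The second comes from \<open>exp (- t) * t \<le> 2 / t\<close>, as
    \<open>block_drift * (2 / t) \<le> 1 / 12\<close> once \<open>24 * block_drift \<le> t\<close>;
    its summand 1 keeps \<open>t\<close> positive.\<close>
  define K where "K = max (block_jump + 1) (24 * block_drift + 1)"
  have tail: "block_drift * exp (- t) * t \<le> 1 / 12" if "K \<le> t" for t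
  proof -
    have bd: "0 \<le> block_drift" using c_nonneg by (simp add: block_drift_def)
    then have t: "0 < t" "24 * block_drift \<le> t" using that by (auto simp: K_def)
    have "t\<^sup>2 / 2 \<le> exp t" using exp_lower_Taylor_quadratic[of t] t by simp
    then have "exp (- t) * t \<le> 2 / t" using t by (simp add: exp_minus field_simps power2_eq_square)
    then have "block_drift * (exp (- t) * t) \<le> block_drift * (2 / t)"
      using bd by (intro mult_left_mono) auto
    also have "\<dots> \<le> 1 / 12" using t by (simp add: field_simps)
    finally show ?thesis by (simp add: mult.assoc)
  qed
  show ?thesis
  proof (intro exI[of _ "K + 2 * L"] allI)
    fix u0
    interpret drift_tree "2 ^ block" "\<lambda>n k. mean u0 (block * n) k" block_jump block_drift
      by (rule mean_tree)
    have "AE y in lborel. y \<in> {0..<1} \<longrightarrow>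
        infinite {n. \<bar>mean u0 (block * n) (cell (2 ^ block) n y)\<bar> \<le> K}"
      using tail by (intro AE_recurrent) (auto simp: K_def)
    then show "AE y in lborel. y \<in> {0..<1} \<longrightarrow> infinite {i. \<bar>orbit u0 y i\<bar> \<le> K + 2 * L}"
    proof eventually_elim
      case (elim y)
      show ?case
      proof
        assume y: "y \<in> {0..<1}"
        let ?M = "{n. \<bar>mean u0 (block * n) (cell (2 ^ block) n y)\<bar> \<le> K}"
        have "infinite ((\<lambda>n. block * n) ` ?M)"
          using elim y block_pos by (subst finite_image_iff) (auto intro: inj_onI)
        moreover have "(\<lambda>n. block * n) ` ?M \<subseteq> {i. \<bar>orbit u0 y i\<bar> \<le> K + 2 * L}"
        proof clarify
          fix n assume "\<bar>mean u0 (block * n) (cell (2 ^ block) n y)\<bar> \<le> K"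
          then show "\<bar>orbit u0 y (block * n)\<bar> \<le> K + 2 * L"
            using orbit_close_mean[OF y, of u0 n] by linarith
        qed
        ultimately show "infinite {i. \<bar>orbit u0 y i\<bar> \<le> K + 2 * L}"
          using infinite_super by blast
      qed
    qed
  qed
qed

lemma orbit_zero_density:
  "AE y in lborel. y \<in> {0..<1} \<longrightarrow>
    (\<lambda>n. (\<Sum>i<n. of_bool (\<bar>orbit u0 y i\<bar> \<le> B)) / real n) \<longlonglongrightarrow> 0"
proof -
  \<comment> \<open>\<open>2 * L\<close> covers the distance between orbit and mean at block times,
    \<open>real block * X\<close> the motion of the orbit since the last block time.\<close>
  define B' where "B' = B + 2 * L + real block * X"
  interpret drift_tree "2 ^ block" "\<lambda>n k. mean u0 (block * n) k" block_jump block_drift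
    by (rule mean_tree)
  have X: "0 \<le> X" using increment[of 0 0] by simp
  show ?thesis
    using AE_zero_density[of B']
  proof eventually_elim
    case (elim y)
    show ?case
    proof
      assume y: "y \<in> {0..<1}"
      define f where "f n = (of_bool (\<bar>mean u0 (block * n) (cell (2 ^ block) n y)\<bar> \<le> B') :: real)" for n
      have f_nonneg: "0 \<le> f n" for n by (simp add: f_def)
      have le: "of_bool (\<bar>orbit u0 y i\<bar> \<le> B) \<le> f (i div block)" for i
      proof -
        have "\<bar>orbit u0 y (block * (i div block) + i mod block) - orbit u0 y (block * (i div block))\<bar>
            \<le> real (i mod block) * X" by (rule orbit_steps[OF y])
        also have "\<dots> \<le> real block * X" using X block_pos by (intro mult_right_mono) auto
        finally show ?thesis
          using orbit_close_mean[OF y, of u0 "i div block"] by (auto simp: f_def B'_def)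
      qed
      have "(\<lambda>n. real block * ((\<Sum>i<n. f i) / real n)) \<longlonglongrightarrow> real block * 0"
        using elim y by (intro tendsto_mult_left) (simp add: f_def)
      then have lim: "(\<lambda>n. real block * ((\<Sum>i<n. f i) / real n)) \<longlonglongrightarrow> 0" by simp
      have "(\<Sum>i<n. of_bool (\<bar>orbit u0 y i\<bar> \<le> B)) / real n \<le> real block * ((\<Sum>i<n. f i) / real n)" for n
      proof -
        have "(\<Sum>i<n. of_bool (\<bar>orbit u0 y i\<bar> \<le> B)) \<le> (\<Sum>i<n. f (i div block))"
          by (intro sum_mono le)
        also have "\<dots> \<le> real block * (\<Sum>i<n. f i)"
          by (intro sum_div_le block_pos f_nonneg)
        finally show ?thesis by (simp add: divide_right_mono)
      qed
      then show "(\<lambda>n. (\<Sum>i<n. of_bool (\<bar>orbit u0 y i\<bar> \<le> B)) / real n) \<longlonglongrightarrow> 0"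
        by (intro tendsto_sandwich[OF _ _ tendsto_const lim]) (simp_all add: sum_nonneg)
    qed
  qed
qed

end

section \<open>Perturbations of the logistic fibre maps\<close>

lemma abs_ln_diff_le:
  fixes s t l K :: real
  assumes "0 < l" "l \<le> s" "l \<le> t" "\<bar>s - t\<bar> \<le> K"
  shows "\<bar>ln s - ln t\<bar> \<le> K / l"
proof -
  have *: "ln s - ln t \<le> K / l" if "l \<le> s" "l \<le> t" "\<bar>s - t\<bar> \<le> K" for s t
  proof -
    have "ln s - ln t \<le> (s - t) / t" using that assms(1) by (intro ln_diff_le) auto
    also have "\<dots> \<le> K / l" using that assms(1) by (intro frac_le) auto
    finally show ?thesis .
  qed
  show ?thesis using *[of s t] *[of t s] assms by (simp add: abs_le_iff abs_minus_commute)
qed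

text \<open>The unperturbed fibre map multiplies \<open>x / (1 - x)\<close> by
  \<open>exp (\<xi> y)\<close>, so in this coordinate it is the translation by
  \<open>\<xi> y\<close>.\<close>

definition logit :: "real \<Rightarrow> real" where
  "logit x = ln x - ln (1 - x)"

definition sigmoid :: "real \<Rightarrow> real" where
  "sigmoid u = 1 / (1 + exp (- u))"

lemma sigmoid_in: "0 < sigmoid u" "sigmoid u < 1"
  by (auto simp: sigmoid_def add_pos_pos)

lemma one_minus_sigmoid: "1 - sigmoid u = sigmoid (- u)"
proof -
  have "0 < 1 + exp u" by (simp add: add_pos_pos)
  then show ?thesis by (simp add: sigmoid_def exp_minus divide_simps)
qed

lemma sigmoid_le_exp: "sigmoid u \<le> exp u"
proof -
  have "sigmoid u \<le> 1 / exp (- u)"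
    unfolding sigmoid_def by (intro divide_left_mono) (auto simp: add_pos_pos)
  also have "1 / exp (- u) = exp u" by (simp add: exp_minus inverse_eq_divide)
  finally show ?thesis .
qed

lemma logit_sigmoid [simp]: "logit (sigmoid u) = u"
proof -
  have pos: "0 < 1 + exp (- u)" by (simp add: add_pos_pos)
  then have "1 - sigmoid u = exp (- u) / (1 + exp (- u))"
    by (simp add: sigmoid_def divide_simps)
  then show ?thesis
    using pos by (simp only: logit_def sigmoid_def ln_div exp_gt_zero zero_less_one) simp
qed

lemma sigmoid_logit:
  assumes "0 < x" "x < 1"
  shows "sigmoid (logit x) = x"
proof -
  have "exp (- logit x) = (1 - x) / x" using assms by (simp add: logit_def exp_diff)
  then show ?thesis using assms by (simp add: sigmoid_def diff_divide_distrib)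
qed

lemma sigmoid_mono: "u \<le> v \<Longrightarrow> sigmoid u \<le> sigmoid v"
  unfolding sigmoid_def by (intro divide_left_mono) (auto simp: add_pos_pos)

lemma sigmoid_derivative:
  "(sigmoid has_real_derivative sigmoid u * (1 - sigmoid u)) (at u)"
proof -
  have nz: "1 + exp (- u) \<noteq> 0" using exp_gt_zero[of "- u"] by linarith
  have "((\<lambda>u. 1 / (1 + exp (- u))) has_real_derivative exp (- u) / (1 + exp (- u))\<^sup>2) (at u)"
    using nz by (auto intro!: derivative_eq_intros simp: power2_eq_square)
  moreover have "sigmoid u * (1 - sigmoid u) = exp (- u) / (1 + exp (- u))\<^sup>2"
    using nz by (simp add: sigmoid_def field_simps power2_eq_square)
  ultimately show ?thesis by (simp add: sigmoid_def[abs_def])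
qed

lemma logistic_derivative:
  fixes e t :: real
  assumes "1 + (e - 1) * t \<noteq> 0"
  shows "((\<lambda>t. e * t / (1 + (e - 1) * t)) has_real_derivative e / (1 + (e - 1) * t)\<^sup>2) (at t within S)"
proof -
  have "((\<lambda>t. e * t / (1 + (e - 1) * t)) has_real_derivative
      (e * (1 + (e - 1) * t) - e * t * (e - 1)) / ((1 + (e - 1) * t) * (1 + (e - 1) * t))) (at t within S)"
    by (rule DERIV_divide) (auto intro!: derivative_eq_intros simp: assms)
  moreover have "e * (1 + (e - 1) * t) - e * t * (e - 1) = e" by (simp add: algebra_simps)
  ultimately show ?thesis by (simp only: power2_eq_square)
qed

lemma logistic_denominator_pos:
  fixes e t :: real
  assumes "0 < e" "t \<in> {0..1}"
  shows "0 < 1 + (e - 1) * t"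
proof -
  have "1 + (e - 1) * t = (1 - t) + e * t" by (simp add: algebra_simps)
  moreover have "0 < (1 - t) + e * t" using assms by (cases "t = 0") (auto intro: add_nonneg_pos)
  ultimately show ?thesis by simp
qed

lemma min_le_twice_product:
  fixes x z B :: real
  assumes "x \<in> {0..1}" "z \<le> B * x" "z \<le> B * (1 - x)" "0 \<le> B"
  shows "z \<le> 2 * B * x * (1 - x)"
proof (cases "x \<le> 1 / 2")
  case True
  have "B * x * 1 \<le> B * x * (2 * (1 - x))" using assms True by (intro mult_left_mono) auto
  then show ?thesis using assms by (simp add: mult_ac)
next
  case False
  have "B * (1 - x) * 1 \<le> B * (1 - x) * (2 * x)" using assms False by (intro mult_left_mono) auto
  then show ?thesis using assms by (simp add: mult_ac)
qed

lemma interval_bound: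
  fixes f f' :: "real \<Rightarrow> real"
  assumes "\<And>t. t \<in> {0..1} \<Longrightarrow> (f has_real_derivative f' t) (at t within {0..1})"
    and "\<And>t. t \<in> {0..1} \<Longrightarrow> \<bar>f' t\<bar> \<le> K"
    and "f 0 = 0" "f 1 = 0" "x \<in> {0..1}"
  shows "\<bar>f x\<bar> \<le> K * x" "\<bar>f x\<bar> \<le> K * (1 - x)"
proof -
  have "norm (f x - f z) \<le> K * norm (x - z)" if "z \<in> {0..1}" for z
    using assms that by (intro field_differentiable_bound[of "{0..1}"]) auto
  from this[of 0] this[of 1] assms show "\<bar>f x\<bar> \<le> K * x" "\<bar>f x\<bar> \<le> K * (1 - x)" by auto
qed

text \<open>\<open>r0_small\<close> contains \<open>exp (2 * X)\<close> because the unperturbed map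
  may shrink \<open>x\<close> and \<open>1 - x\<close> by a factor \<open>exp X\<close> each, and
  the error has to stay small relative to the product of the images. \<open>r0_b\<close> leaves a
  motion of at least \<open>b\<close> over the end points, where the unperturbed displacement is at
  least \<open>2 * b\<close>.\<close>

locale logistic_perturbation =
  fixes g D :: "real \<Rightarrow> real \<Rightarrow> real" and \<xi> :: "real \<Rightarrow> real" and X r0 B b :: real
  assumes \<xi>_bound: "y \<in> {0..1} \<Longrightarrow> \<bar>\<xi> y\<bar> \<le> X"
    and deriv: "\<lbrakk>y \<in> {0..1}; x \<in> {0..1}\<rbrakk> \<Longrightarrow> (g y has_real_derivative D y x) (at x within {0..1})"
    and fix_0: "y \<in> {0..1} \<Longrightarrow> g y 0 = 0" and fix_1: "y \<in> {0..1} \<Longrightarrow> g y 1 = 1"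
    and D_close: "\<lbrakk>y \<in> {0..1}; x \<in> {0..1}\<rbrakk> \<Longrightarrow>
      \<bar>D y x - exp (\<xi> y) / (1 + (exp (\<xi> y) - 1) * x)\<^sup>2\<bar> \<le> r0"
    and D_Lipschitz: "\<lbrakk>y \<in> {0..1}; x \<in> {0..1}; y' \<in> {0..1}; x' \<in> {0..1}\<rbrakk> \<Longrightarrow>
      \<bar>D y x - D y' x'\<bar> \<le> B * (\<bar>y - y'\<bar> + \<bar>x - x'\<bar>)"
    and r0_nonneg: "0 \<le> r0" and r0_small: "r0 * exp (2 * X) \<le> 1 / 10" and r0_b: "4 * (r0 * exp X) \<le> b"
    and b_pos: "0 < b"
    and \<xi>_ends: "\<xi> 0 \<le> - 2 * b \<and> 2 * b \<le> \<xi> 1 \<or> \<xi> 1 \<le> - 2 * b \<and> 2 * b \<le> \<xi> 0"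
    and exponent_0: "integral {0..1} (\<lambda>y. ln (D y 0)) = 0"
    and exponent_1: "integral {0..1} (\<lambda>y. ln (D y 1)) = 0"
begin

definition E :: real where "E = exp X"

definition m :: "real \<Rightarrow> real \<Rightarrow> real" where
  "m y x = exp (\<xi> y) * x / (1 + (exp (\<xi> y) - 1) * x)"

definition \<phi> :: "real \<Rightarrow> real \<Rightarrow> real" where
  "\<phi> y u = logit (g y (sigmoid u))"

lemma X_nonneg: "0 \<le> X"
  using \<xi>_bound[of 0] by simp

lemma E_ge_1: "1 \<le> E"
  using X_nonneg by (simp add: E_def)

lemma B_nonneg: "0 \<le> B"
  using D_Lipschitz[of 0 0 0 1] by simp

lemma r0_E2: "r0 * E\<^sup>2 \<le> 1 / 10"
  using r0_small by (simp add: E_def exp_double)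

lemma r0_E: "r0 * E \<le> 1 / 10"
proof -
  have "r0 * E * 1 \<le> r0 * E * E" using r0_nonneg E_ge_1 by (intro mult_left_mono) auto
  then show ?thesis using r0_E2 by (simp add: power2_eq_square mult.assoc)
qed

lemma r0_le: "r0 \<le> 1 / (10 * E)"
  using r0_E E_ge_1 by (simp add: field_simps)

lemma exp_\<xi>:
  assumes "y \<in> {0..1}"
  shows "1 / E \<le> exp (\<xi> y)" "exp (\<xi> y) \<le> E"
proof -
  have "1 / E = exp (- X)" by (simp add: E_def exp_minus inverse_eq_divide)
  moreover have "- X \<le> \<xi> y" "\<xi> y \<le> X" using \<xi>_bound[OF assms] by linarith+
  ultimately show "1 / E \<le> exp (\<xi> y)" "exp (\<xi> y) \<le> E" by (simp_all add: E_def)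
qed

lemma m_derivative:
  assumes "y \<in> {0..1}" "x \<in> {0..1}"
  shows "(m y has_real_derivative exp (\<xi> y) / (1 + (exp (\<xi> y) - 1) * x)\<^sup>2) (at x within {0..1})"
  unfolding m_def[abs_def] using logistic_denominator_pos[OF _ assms(2), of "exp (\<xi> y)"]
  by (intro logistic_derivative) auto

text \<open>A merely uniform bound on the error is useless in the logit coordinate near the ends.
  Both maps fix 0 and 1 and their derivatives differ by at most \<open>r0\<close>, so the error
  vanishes linearly at both ends.\<close>

lemma g_minus_m:
  assumes "y \<in> {0..1}" "x \<in> {0..1}"
  shows "\<bar>g y x - m y x\<bar> \<le> r0 * x" "\<bar>g y x - m y x\<bar> \<le> r0 * (1 - x)"
proof -
  have d: "((\<lambda>x. g y x - m y x) has_real_derivative (D y x - exp (\<xi> y) / (1 + (exp (\<xi> y) - 1) * x)\<^sup>2))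
      (at x within {0..1})" if "x \<in> {0..1}" for x
    using assms that by (intro DERIV_diff deriv m_derivative)
  have e: "g y 0 - m y 0 = 0" "g y 1 - m y 1 = 0"
    using assms fix_0 fix_1 by (auto simp: m_def)
  show "\<bar>g y x - m y x\<bar> \<le> r0 * x" "\<bar>g y x - m y x\<bar> \<le> r0 * (1 - x)"
    using interval_bound[OF d _ e assms(2)] D_close[OF assms(1)] by auto
qed

lemma one_minus_m:
  assumes "x \<in> {0..1}"
  shows "1 - m y x = (1 - x) / (1 + (exp (\<xi> y) - 1) * x)"
proof -
  define w where "w = 1 + (exp (\<xi> y) - 1) * x"
  have "w \<noteq> 0" using logistic_denominator_pos[OF exp_gt_zero assms, of "\<xi> y"] by (simp add: w_def)
  then have "1 - m y x = (w - exp (\<xi> y) * x) / w"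
    by (simp add: m_def w_def[symmetric] diff_divide_distrib)
  also have "w - exp (\<xi> y) * x = 1 - x" by (simp add: w_def algebra_simps)
  finally show ?thesis by (simp only: w_def)
qed

lemma m_lower:
  assumes "y \<in> {0..1}" "x \<in> {0..1}"
  shows "x / E \<le> m y x" "(1 - x) / E \<le> 1 - m y x"
proof -
  define e where "e = exp (\<xi> y)"
  define w where "w = 1 + (e - 1) * x"
  have e: "0 < e" "1 \<le> e * E" "e \<le> E"
    using exp_\<xi>[OF assms(1)] E_ge_1 by (auto simp: e_def field_simps)
  have w: "0 < w" using logistic_denominator_pos[OF e(1) assms(2)] by (simp add: w_def)
  have weq: "w = (1 - x) * 1 + x * e" by (simp add: w_def algebra_simps)
  have "w \<le> (1 - x) * E + x * E"
    unfolding weq using e E_ge_1 assms(2) by (intro add_mono mult_left_mono) auto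
  then have wE: "w \<le> E" by (simp add: algebra_simps)
  have "e * 1 \<le> e * E" using e E_ge_1 by (intro mult_left_mono) auto
  then have "w \<le> (1 - x) * (e * E) + x * (e * E)"
    unfolding weq using e E_ge_1 assms(2) by (intro add_mono mult_left_mono) auto
  then have weE: "w \<le> e * E" by (simp add: algebra_simps)
  have "x * w \<le> x * (e * E)" using weE assms(2) by (intro mult_left_mono) auto
  then show "x / E \<le> m y x"
    using w E_ge_1 unfolding m_def e_def[symmetric] w_def[symmetric]
    by (simp add: divide_le_eq le_divide_eq mult_ac)
  have "1 - m y x = (1 - x) / w"
    unfolding w_def e_def by (rule one_minus_m[OF assms(2)])
  moreover have "(1 - x) / E \<le> (1 - x) / w" using wE w assms(2) by (intro divide_left_mono) auto
  ultimately show "(1 - x) / E \<le> 1 - m y x" by simp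
qed

lemma g_relative:
  assumes "y \<in> {0..1}" "x \<in> {0..1}"
  shows "\<bar>g y x - m y x\<bar> \<le> r0 * E * m y x" "\<bar>g y x - m y x\<bar> \<le> r0 * E * (1 - m y x)"
proof -
  have "x \<le> E * m y x" "1 - x \<le> E * (1 - m y x)"
    using m_lower[OF assms] E_ge_1 by (auto simp: field_simps)
  then have "r0 * x \<le> r0 * (E * m y x)" "r0 * (1 - x) \<le> r0 * (E * (1 - m y x))"
    using r0_nonneg by (auto intro!: mult_left_mono)
  then show "\<bar>g y x - m y x\<bar> \<le> r0 * E * m y x" "\<bar>g y x - m y x\<bar> \<le> r0 * E * (1 - m y x)"
    using g_minus_m[OF assms] by (auto simp: mult.assoc)
qed

lemma m_in:
  assumes "y \<in> {0..1}" "0 < x" "x < 1"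
  shows "0 < m y x" "m y x < 1"
proof -
  have "0 < x / E" "0 < (1 - x) / E" using assms E_ge_1 by auto
  moreover have "x / E \<le> m y x" "(1 - x) / E \<le> 1 - m y x" using m_lower[of y x] assms by auto
  ultimately show "0 < m y x" "m y x < 1" by auto
qed

lemma g_vs_m:
  assumes "y \<in> {0..1}" "0 < x" "x < 1"
  shows "9 / 10 * m y x \<le> g y x" "9 / 10 * (1 - m y x) \<le> 1 - g y x"
proof -
  have "r0 * E * m y x \<le> 1 / 10 * m y x" "r0 * E * (1 - m y x) \<le> 1 / 10 * (1 - m y x)"
    using r0_E m_in[OF assms] by (auto intro!: mult_right_mono)
  then show "9 / 10 * m y x \<le> g y x" "9 / 10 * (1 - m y x) \<le> 1 - g y x"
    using g_relative[of y x] assms by auto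
qed

lemma g_lower:
  assumes "y \<in> {0..1}" "0 < x" "x < 1"
  shows "x / (2 * E) \<le> g y x" "(1 - x) / (2 * E) \<le> 1 - g y x"
proof -
  have "x / E \<le> m y x" "(1 - x) / E \<le> 1 - m y x" using m_lower[of y x] assms by auto
  moreover have "0 < x / E" "0 < (1 - x) / E" using assms E_ge_1 by auto
  ultimately show "x / (2 * E) \<le> g y x" "(1 - x) / (2 * E) \<le> 1 - g y x"
    using g_vs_m[OF assms] by auto
qed

lemma g_in:
  assumes "y \<in> {0..1}" "0 < x" "x < 1"
  shows "0 < g y x" "g y x < 1"
  using g_vs_m[OF assms] m_in[OF assms] by auto

text \<open>The unperturbed map is the translation by \<open>\<xi> y\<close>. The relative errors of
  \<open>g y x\<close> and \<open>1 - g y x\<close> are at most \<open>r0 * E\<close>, and each of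
  the two logarithms contributes at most \<open>2 * (r0 * E)\<close>.\<close>

lemma \<phi>_near_shift:
  assumes "y \<in> {0..1}"
  shows "\<bar>\<phi> y u - u - \<xi> y\<bar> \<le> 4 * (r0 * E)"
proof -
  define x where "x = sigmoid u"
  have x: "0 < x" "x < 1" using sigmoid_in by (auto simp: x_def)
  define w where "w = 1 + (exp (\<xi> y) - 1) * x"
  have w: "0 < w" using x unfolding w_def by (intro logistic_denominator_pos) auto
  have mm: "m y x = exp (\<xi> y) * x / w" "1 - m y x = (1 - x) / w"
    using one_minus_m[of x y] x by (simp_all add: m_def w_def)
  have "logit (m y x) = \<xi> y + logit x"
    unfolding logit_def mm(2) unfolding mm(1) using x w by (simp add: ln_mult ln_div)
  then have lm: "logit (m y x) = \<xi> y + u" by (simp add: x_def)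
  note min = m_in[OF assms x] and rel = g_relative[OF assms, of x] and gm = g_vs_m[OF assms x]
  have d: "r0 * E * z / (9 / 10 * z) \<le> 2 * (r0 * E)" if "0 < z" for z
    using that r0_nonneg E_ge_1 by simp
  have "\<bar>ln (g y x) - ln (m y x)\<bar> \<le> (r0 * E * m y x) / (9 / 10 * m y x)"
    using min gm rel x by (intro abs_ln_diff_le) auto
  also have "\<dots> \<le> 2 * (r0 * E)" using min by (intro d) simp
  finally have 1: "\<bar>ln (g y x) - ln (m y x)\<bar> \<le> 2 * (r0 * E)" .
  have "\<bar>ln (1 - g y x) - ln (1 - m y x)\<bar> \<le> (r0 * E * (1 - m y x)) / (9 / 10 * (1 - m y x))"
    using min gm rel x by (intro abs_ln_diff_le) auto
  also have "\<dots> \<le> 2 * (r0 * E)" using min by (intro d) simp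
  finally have 2: "\<bar>ln (1 - g y x) - ln (1 - m y x)\<bar> \<le> 2 * (r0 * E)" .
  show ?thesis
    using 1 2 lm by (simp add: \<phi>_def x_def[symmetric] logit_def)
qed

text \<open>The derivative \<open>D y x * x * (1 - x) / (g y x * (1 - g y x))\<close> equals 1 for
  the unperturbed map. The perturbation costs at most a factor 11/10 in the numerator and 81/100 in
  the denominator, and 110/81 is below 3/2.\<close>

lemma \<phi>_Lipschitz_u:
  assumes "y \<in> {0..1}"
  shows "\<bar>\<phi> y u - \<phi> y v\<bar> \<le> 3 / 2 * \<bar>u - v\<bar>"
proof -
  define f' where "f' u = D y (sigmoid u) * (sigmoid u * (1 - sigmoid u)) /
      (g y (sigmoid u) * (1 - g y (sigmoid u)))" for u
  have "(\<phi> y has_real_derivative f' u) (at u within UNIV)" for u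
  proof -
    define x where "x = sigmoid u"
    have x: "0 < x" "x < 1" using sigmoid_in by (auto simp: x_def)
    have "(g y has_real_derivative D y x) (at x)"
      using deriv[OF assms, of x] x at_within_Icc_at[of 0 x 1] by simp
    then have G: "((\<lambda>u. g y (sigmoid u)) has_real_derivative D y x * (x * (1 - x))) (at u)"
      unfolding x_def by (rule DERIV_chain2) (rule sigmoid_derivative)
    have gin: "0 < g y (sigmoid u)" "g y (sigmoid u) < 1" using g_in[OF assms x] by (auto simp: x_def)
    have "((\<lambda>u. ln (g y (sigmoid u)) - ln (1 - g y (sigmoid u))) has_real_derivative
        (D y x * (x * (1 - x)) / g y x + D y x * (x * (1 - x)) / (1 - g y x))) (at u)"
      using gin by (auto intro!: derivative_eq_intros G simp: x_def)
    moreover have "D y x * (x * (1 - x)) / g y x + D y x * (x * (1 - x)) / (1 - g y x) = f' u"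
      using gin by (simp add: f'_def x_def[symmetric] divide_simps) (simp add: algebra_simps)
    ultimately show ?thesis by (simp add: \<phi>_def[abs_def] logit_def)
  qed
  moreover have "norm (f' u) \<le> 3 / 2" for u
  proof -
    define x where "x = sigmoid u"
    have x: "0 < x" "x < 1" using sigmoid_in by (auto simp: x_def)
    define w where "w = 1 + (exp (\<xi> y) - 1) * x"
    have w: "0 < w" using x unfolding w_def by (intro logistic_denominator_pos) auto
    define q where "q = m y x * (1 - m y x)"
    have mm: "m y x = exp (\<xi> y) * x / w" "1 - m y x = (1 - x) / w"
      using one_minus_m[of x y] x by (simp_all add: m_def w_def)
    note min = m_in[OF assms x] and gm = g_vs_m[OF assms x] and gin = g_in[OF assms x]
    have q: "0 < q" using min by (simp add: q_def)
    have q_eq: "q = exp (\<xi> y) / w\<^sup>2 * (x * (1 - x))"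
      unfolding q_def mm(2) unfolding mm(1) by (simp add: power2_eq_square)
    have "\<bar>D y x\<bar> * (x * (1 - x)) \<le> (exp (\<xi> y) / w\<^sup>2 + r0) * (x * (1 - x))"
    proof (intro mult_right_mono)
      have "0 \<le> exp (\<xi> y) / w\<^sup>2" by simp
      moreover have "\<bar>D y x - exp (\<xi> y) / w\<^sup>2\<bar> \<le> r0"
        unfolding w_def using D_close[OF assms, of x] x by simp
      ultimately show "\<bar>D y x\<bar> \<le> exp (\<xi> y) / w\<^sup>2 + r0" by linarith
    qed (use x in auto)
    also have "\<dots> = q + r0 * (x * (1 - x))" by (simp add: q_eq algebra_simps)
    also have "\<dots> \<le> q + 1 / 10 * q"
    proof (intro add_left_mono)
      have "(x / E) * ((1 - x) / E) \<le> q"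
        unfolding q_def using m_lower[OF assms, of x] x E_ge_1 min by (intro mult_mono) auto
      then have "x * (1 - x) \<le> E\<^sup>2 * q" using E_ge_1 by (simp add: field_simps power2_eq_square)
      then have "r0 * (x * (1 - x)) \<le> r0 * (E\<^sup>2 * q)" using r0_nonneg by (rule mult_left_mono)
      also have "\<dots> = (r0 * E\<^sup>2) * q" by simp
      also have "\<dots> \<le> 1 / 10 * q" using r0_E2 q by (intro mult_right_mono) auto
      finally show "r0 * (x * (1 - x)) \<le> 1 / 10 * q" .
    qed
    finally have num: "\<bar>D y x\<bar> * (x * (1 - x)) \<le> 11 / 10 * q" by simp
    have "(9 / 10 * m y x) * (9 / 10 * (1 - m y x)) \<le> g y x * (1 - g y x)"
      using gm min gin by (intro mult_mono) auto
    then have den: "81 / 100 * q \<le> g y x * (1 - g y x)" by (simp add: q_def algebra_simps)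
    have gpos: "0 < g y x * (1 - g y x)" using gin by simp
    have "\<bar>D y x\<bar> * (x * (1 - x)) \<le> 3 / 2 * (g y x * (1 - g y x))" using num den q by linarith
    moreover have "norm (f' u) = \<bar>D y x\<bar> * (x * (1 - x)) / (g y x * (1 - g y x))"
      using gin x by (simp add: f'_def x_def[symmetric] abs_mult)
    ultimately show ?thesis using gpos by (simp add: divide_le_eq)
  qed
  ultimately have "norm (\<phi> y u - \<phi> y v) \<le> 3 / 2 * norm (u - v)"
    by (intro field_differentiable_bound[of UNIV "\<phi> y" f']) auto
  then show ?thesis by simp
qed

text \<open>The difference of two fibre maps vanishes at both ends and has derivative at most
  \<open>B * \<bar>y - y'\<bar>\<close> in size. It is thus small relative to both \<open>x\<close>
  and \<open>1 - x\<close>, which makes the bound uniform in \<open>u\<close>.\<close>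

lemma \<phi>_Lipschitz_y:
  assumes "y \<in> {0..1}" "y' \<in> {0..1}"
  shows "\<bar>\<phi> y u - \<phi> y' u\<bar> \<le> 4 * E * B * \<bar>y - y'\<bar>"
proof -
  define x where "x = sigmoid u"
  have x: "0 < x" "x < 1" using sigmoid_in by (auto simp: x_def)
  define K where "K = B * \<bar>y - y'\<bar>"
  have d: "((\<lambda>x. g y x - g y' x) has_real_derivative D y x - D y' x) (at x within {0..1})"
    if "x \<in> {0..1}" for x using assms that by (intro DERIV_diff deriv)
  have e: "g y 0 - g y' 0 = 0" "g y 1 - g y' 1 = 0" using assms fix_0 fix_1 by auto
  have "\<bar>g y x - g y' x\<bar> \<le> K * x" "\<bar>g y x - g y' x\<bar> \<le> K * (1 - x)"
    using interval_bound[OF d _ e, where x = x and K = K] x D_Lipschitz[OF assms(1) _ assms(2)]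
    by (fastforce simp: K_def)+
  then have close: "\<bar>g y x - g y' x\<bar> \<le> K * x" "\<bar>(1 - g y x) - (1 - g y' x)\<bar> \<le> K * (1 - x)"
    by auto
  have pos: "0 < x / (2 * E)" "0 < (1 - x) / (2 * E)" using x E_ge_1 by auto
  note low = g_lower[OF assms(1) x] g_lower[OF assms(2) x]
  have "\<bar>ln (g y x) - ln (g y' x)\<bar> \<le> K * x / (x / (2 * E))"
    by (rule abs_ln_diff_le[OF pos(1) low(1) low(3) close(1)])
  moreover have "\<bar>ln (1 - g y x) - ln (1 - g y' x)\<bar> \<le> K * (1 - x) / ((1 - x) / (2 * E))"
    by (rule abs_ln_diff_le[OF pos(2) low(2) low(4) close(2)])
  moreover have "K * x / (x / (2 * E)) = 2 * E * K" "K * (1 - x) / ((1 - x) / (2 * E)) = 2 * E * K"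
    using x by auto
  ultimately have "\<bar>\<phi> y u - \<phi> y' u\<bar> \<le> 4 * E * K"
    by (simp add: \<phi>_def x_def[symmetric] logit_def)
  then show ?thesis by (simp add: K_def mult.assoc)
qed

lemma D_ends_lower:
  assumes "y \<in> {0..1}"
  shows "1 / (2 * E) \<le> D y 0" "1 / (2 * E) \<le> D y 1"
proof -
  define e where "e = exp (\<xi> y)"
  have e: "0 < e" "1 / E \<le> e" "e \<le> E" using exp_\<xi>[OF assms] by (auto simp: e_def)
  have "1 / E \<le> 1 / e" using e by (intro divide_left_mono) auto
  have "1 / e = e / (1 + (e - 1) * 1)\<^sup>2" using e by (simp add: power2_eq_square)
  have r: "r0 \<le> 1 / E / 2"
  proof -
    have "1 / (10 * E) \<le> 1 / (2 * E)" using E_ge_1 by (intro divide_left_mono) auto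
    then show ?thesis using r0_le by simp
  qed
  have "\<bar>D y 0 - e\<bar> \<le> r0" using D_close[OF assms, of 0] by (simp add: e_def)
  then show "1 / (2 * E) \<le> D y 0" using r e by simp
  have "\<bar>D y 1 - 1 / e\<bar> \<le> r0"
    using D_close[OF assms, of 1] \<open>1 / e = e / (1 + (e - 1) * 1)\<^sup>2\<close> by (simp add: e_def)
  then show "1 / (2 * E) \<le> D y 1" using r \<open>1 / E \<le> 1 / e\<close> by simp
qed

text \<open>A bound for \<open>\<bar>D y x - 1\<bar>\<close> on the square, whose points are at
  distance at most 2 from the corner in the sum norm of \<open>D_Lipschitz\<close>.\<close>

definition B1 :: real where "B1 = 2 * B + \<bar>D 0 0\<bar> + 1"

lemma B1_nonneg: "0 \<le> B1"
  using B_nonneg by (simp add: B1_def)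

lemma g_minus_id:
  assumes "y \<in> {0..1}" "x \<in> {0..1}"
  shows "\<bar>g y x - x\<bar> \<le> 2 * B1 * x * (1 - x)"
proof -
  have d: "((\<lambda>x. g y x - x) has_real_derivative D y x - 1) (at x within {0..1})"
    if "x \<in> {0..1}" for x using assms that by (intro DERIV_diff deriv DERIV_ident)
  have bd: "\<bar>D y x - 1\<bar> \<le> B1" if "x \<in> {0..1}" for x
  proof -
    have "\<bar>D y x - D 0 0\<bar> \<le> B * (\<bar>y - 0\<bar> + \<bar>x - 0\<bar>)"
      using assms that by (intro D_Lipschitz) auto
    also have "\<dots> \<le> B * 2" using assms that B_nonneg by (intro mult_left_mono) auto
    finally show ?thesis by (simp add: B1_def)
  qed
  have e: "g y 0 - 0 = 0" "g y 1 - 1 = 0" using assms fix_0 fix_1 by auto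
  show ?thesis
    using interval_bound[OF d bd e assms(2)] by (intro min_le_twice_product assms B1_nonneg)
qed

lemma log_ratio_id:
  assumes "y \<in> {0..1}" "0 < x" "x < 1"
  shows "\<bar>ln (g y x) - ln x\<bar> \<le> 4 * E * B1 * (1 - x)" "\<bar>ln (1 - g y x) - ln (1 - x)\<bar> \<le> 4 * E * B1 * x"
proof -
  have id: "\<bar>g y x - x\<bar> \<le> 2 * B1 * x * (1 - x)" using assms by (intro g_minus_id) auto
  have low: "x / (2 * E) \<le> x" "(1 - x) / (2 * E) \<le> 1 - x"
    using assms E_ge_1 by (auto simp: divide_le_eq mult_le_cancel_left1)
  have "\<bar>ln (g y x) - ln x\<bar> \<le> 2 * B1 * x * (1 - x) / (x / (2 * E))"
    using g_lower[OF assms] assms id low E_ge_1 by (intro abs_ln_diff_le) auto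
  then show "\<bar>ln (g y x) - ln x\<bar> \<le> 4 * E * B1 * (1 - x)" using assms by (simp add: mult_ac)
  have "\<bar>ln (1 - g y x) - ln (1 - x)\<bar> \<le> 2 * B1 * x * (1 - x) / ((1 - x) / (2 * E))"
    using g_lower[OF assms] assms id low E_ge_1 by (intro abs_ln_diff_le) auto
  then show "\<bar>ln (1 - g y x) - ln (1 - x)\<bar> \<le> 4 * E * B1 * x" using assms by (simp add: mult_ac)
qed

lemma linearization:
  assumes "y \<in> {0..1}" "z \<in> {0, 1}" "x \<in> {0..1}"
  shows "\<bar>g y x - g y z - D y z * (x - z)\<bar> \<le> B * \<bar>x - z\<bar>\<^sup>2"
proof -
  let ?S = "closed_segment z x"
  have sub: "?S \<subseteq> {0..1}" using assms by (intro closed_segment_subset) auto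
  have "norm ((g y x - D y z * x) - (g y z - D y z * z)) \<le> (B * \<bar>x - z\<bar>) * norm (x - z)"
  proof (rule field_differentiable_bound)
    fix t assume t: "t \<in> ?S"
    then have t01: "t \<in> {0..1}" using sub by auto
    have "(g y has_real_derivative D y t) (at t within ?S)"
      using deriv[OF assms(1) t01] sub by (rule DERIV_subset)
    then show "((\<lambda>t. g y t - D y z * t) has_real_derivative D y t - D y z) (at t within ?S)"
      by (auto intro!: derivative_eq_intros)
    have "\<bar>D y t - D y z\<bar> \<le> B * (\<bar>y - y\<bar> + \<bar>t - z\<bar>)"
      using assms t01 by (intro D_Lipschitz) auto
    also have "\<dots> \<le> B * \<bar>x - z\<bar>"
      using t B_nonneg segment_bound1[OF t] by (intro mult_left_mono) auto
    finally show "norm (D y t - D y z) \<le> B * \<bar>x - z\<bar>" by simp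
  qed auto
  then show ?thesis by (simp add: algebra_simps power2_eq_square)
qed

text \<open>By linearization at 0, \<open>ln (g y x)\<close> is \<open>ln (D y 0) + ln x\<close> up
  to \<open>O(x)\<close>, while \<open>ln (1 - g y x)\<close> differs from \<open>ln (1 - x)\<close>
  by \<open>O(x)\<close>; finally \<open>x \<le> exp u\<close>.\<close>

lemma \<phi>_left:
  assumes "y \<in> {0..1}"
  shows "\<bar>\<phi> y u - u - ln (D y 0)\<bar> \<le> (2 * E * B + 4 * E * B1) * exp u"
proof -
  define x where "x = sigmoid u"
  have x: "0 < x" "x < 1" using sigmoid_in by (auto simp: x_def)
  have D0: "1 / (2 * E) \<le> D y 0" "0 < D y 0"
    using D_ends_lower[OF assms] E_ge_1 by (auto intro: less_le_trans[of 0 "1 / (2 * E)"])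
  have "\<bar>g y x - D y 0 * x\<bar> \<le> B * x\<^sup>2"
    using linearization[OF assms, of 0 x] x fix_0[OF assms] by simp
  moreover have "x / (2 * E) \<le> D y 0 * x" using mult_right_mono[OF D0(1), of x] x by simp
  ultimately have "\<bar>ln (g y x) - ln (D y 0 * x)\<bar> \<le> B * x\<^sup>2 / (x / (2 * E))"
    using g_lower[OF assms x] x E_ge_1 by (intro abs_ln_diff_le) auto
  also have "\<dots> = 2 * E * B * x" using x by (simp add: power2_eq_square)
  finally have 1: "\<bar>ln (g y x) - ln (D y 0 * x)\<bar> \<le> 2 * E * B * x" .
  have 2: "\<bar>ln (1 - g y x) - ln (1 - x)\<bar> \<le> 4 * E * B1 * x" by (rule log_ratio_id[OF assms x])
  have "ln (D y 0 * x) = ln (D y 0) + ln x" using x D0 by (simp add: ln_mult)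
  moreover have "\<phi> y u = ln (g y x) - ln (1 - g y x)" "u = ln x - ln (1 - x)"
    using logit_sigmoid[of u] by (simp_all add: \<phi>_def logit_def x_def)
  ultimately have "\<bar>\<phi> y u - u - ln (D y 0)\<bar> \<le> 2 * E * B * x + 4 * E * B1 * x"
    using 1 2 by linarith
  also have "\<dots> = (2 * E * B + 4 * E * B1) * x" by (simp add: algebra_simps)
  also have "\<dots> \<le> (2 * E * B + 4 * E * B1) * exp u"
    using E_ge_1 B_nonneg B1_nonneg sigmoid_le_exp[of u] by (intro mult_left_mono) (auto simp: x_def)
  finally show ?thesis .
qed

text \<open>The mirror image at \<open>x = 1\<close>: the two logarithms exchange their roles, which
  produces the minus sign before \<open>ln (D y 1)\<close>.\<close>

lemma \<phi>_right:
  assumes "y \<in> {0..1}"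
  shows "\<bar>\<phi> y u - u - - ln (D y 1)\<bar> \<le> (2 * E * B + 4 * E * B1) * exp (- u)"
proof -
  define x where "x = sigmoid u"
  have x: "0 < x" "x < 1" using sigmoid_in by (auto simp: x_def)
  have D1: "1 / (2 * E) \<le> D y 1" "0 < D y 1"
    using D_ends_lower[OF assms] E_ge_1 by (auto intro: less_le_trans[of 0 "1 / (2 * E)"])
  have "\<bar>g y x - 1 - D y 1 * (x - 1)\<bar> \<le> B * (1 - x)\<^sup>2"
    using linearization[OF assms, of 1 x] x fix_1[OF assms] by (simp add: power2_commute)
  moreover have "(1 - g y x) - D y 1 * (1 - x) = - (g y x - 1 - D y 1 * (x - 1))"
    by (simp add: algebra_simps)
  ultimately have "\<bar>(1 - g y x) - D y 1 * (1 - x)\<bar> \<le> B * (1 - x)\<^sup>2" by (simp only: abs_minus_cancel)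
  moreover have "(1 - x) / (2 * E) \<le> D y 1 * (1 - x)" using mult_right_mono[OF D1(1), of "1 - x"] x by simp
  ultimately have "\<bar>ln (1 - g y x) - ln (D y 1 * (1 - x))\<bar> \<le> B * (1 - x)\<^sup>2 / ((1 - x) / (2 * E))"
    using g_lower[OF assms x] x E_ge_1 by (intro abs_ln_diff_le) auto
  also have "\<dots> = 2 * E * B * (1 - x)" using x by (simp add: power2_eq_square)
  finally have 1: "\<bar>ln (1 - g y x) - ln (D y 1 * (1 - x))\<bar> \<le> 2 * E * B * (1 - x)" .
  have 2: "\<bar>ln (g y x) - ln x\<bar> \<le> 4 * E * B1 * (1 - x)" by (rule log_ratio_id[OF assms x])
  have "ln (D y 1 * (1 - x)) = ln (D y 1) + ln (1 - x)" using x D1 by (simp add: ln_mult)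
  moreover have "\<phi> y u = ln (g y x) - ln (1 - g y x)" "u = ln x - ln (1 - x)"
    using logit_sigmoid[of u] by (simp_all add: \<phi>_def logit_def x_def)
  ultimately have "\<bar>\<phi> y u - u - - ln (D y 1)\<bar> \<le> 2 * E * B * (1 - x) + 4 * E * B1 * (1 - x)"
    using 1 2 by linarith
  also have "\<dots> = (2 * E * B + 4 * E * B1) * (1 - x)" by (simp add: algebra_simps)
  also have "\<dots> \<le> (2 * E * B + 4 * E * B1) * exp (- u)"
    using E_ge_1 B_nonneg B1_nonneg sigmoid_le_exp[of "- u"] one_minus_sigmoid[of u]
    by (intro mult_left_mono) (auto simp: x_def)
  finally show ?thesis .
qed

lemma ln_D_has_integral:
  assumes "z \<in> {0, 1}" "integral {0..1} (\<lambda>y. ln (D y z)) = 0"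
  shows "((\<lambda>y. ln (D y z)) has_integral 0) {0..1}"
proof -
  have "B-lipschitz_on {0..1} (\<lambda>y. D y z)"
  proof (rule lipschitz_onI)
    fix s t :: real assume "s \<in> {0..1}" "t \<in> {0..1}"
    then have "\<bar>D s z - D t z\<bar> \<le> B * (\<bar>s - t\<bar> + \<bar>z - z\<bar>)"
      using assms(1) by (intro D_Lipschitz) auto
    then show "dist (D s z) (D t z) \<le> B * dist s t" by (simp add: dist_real_def)
  qed (rule B_nonneg)
  then have "continuous_on {0..1} (\<lambda>y. D y z)" by (rule lipschitz_on_continuous_on)
  moreover have "D y z \<noteq> 0" if "y \<in> {0..1}" for y
  proof -
    have "0 < 1 / (2 * E)" using E_ge_1 by simp
    then show ?thesis using D_ends_lower[OF that] assms(1) by auto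
  qed
  ultimately have "continuous_on {0..1} (\<lambda>y. ln (D y z))" by (intro continuous_on_ln) auto
  then show ?thesis using assms(2) by (metis integrable_continuous_real integrable_integral)
qed

sublocale neutral_fibre \<phi> "\<lambda>y. ln (D y 0)" "\<lambda>y. - ln (D y 1)"
  "4 * E * B" "2 * E * B + 4 * E * B1" "X + 1" b
proof
  show "0 \<le> 4 * E * B" "0 \<le> 2 * E * B + 4 * E * B1"
    using E_ge_1 B_nonneg B1_nonneg by auto
  show "\<bar>\<phi> y u - \<phi> y' u'\<bar> \<le> 3 / 2 * \<bar>u - u'\<bar> + 4 * E * B * \<bar>y - y'\<bar>"
    if "y \<in> {0..1}" "y' \<in> {0..1}" for y y' u u'
    using \<phi>_Lipschitz_u[OF that(1), of u u'] \<phi>_Lipschitz_y[OF that, of u'] by linarith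
  show "((\<lambda>y. ln (D y 0)) has_integral 0) {0..1}"
    by (intro ln_D_has_integral exponent_0) simp
  show "((\<lambda>y. - ln (D y 1)) has_integral 0) {0..1}"
    using has_integral_neg[OF ln_D_has_integral[OF _ exponent_1]] by simp
  \<comment> \<open>The perturbation contributes at most \<open>4 * (r0 * E) \<le> 4 / 10\<close>,
    which the summand 1 absorbs.\<close>
  show "\<bar>\<phi> y u - u\<bar> \<le> X + 1" if "y \<in> {0..1}" for y u
    using \<phi>_near_shift[OF that, of u] \<xi>_bound[OF that] r0_E by linarith
  have "\<bar>\<phi> y u - u - \<xi> y\<bar> \<le> b" if "y \<in> {0..1}" for y u
    using \<phi>_near_shift[OF that, of u] r0_b by (simp add: E_def)
  from this[of 0] this[of 1]
  have near: "\<bar>\<phi> 0 u - u - \<xi> 0\<bar> \<le> b" "\<bar>\<phi> 1 u - u - \<xi> 1\<bar> \<le> b" for u by auto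
  show "(\<forall>u. \<phi> 0 u \<le> u - b) \<and> (\<forall>u. u + b \<le> \<phi> 1 u) \<or> (\<forall>u. \<phi> 1 u \<le> u - b) \<and> (\<forall>u. u + b \<le> \<phi> 0 u)"
    using \<xi>_ends
  proof
    assume h: "\<xi> 0 \<le> - 2 * b \<and> 2 * b \<le> \<xi> 1"
    have "\<phi> 0 u \<le> u - b \<and> u + b \<le> \<phi> 1 u" for u using near[of u] h by linarith
    then show ?thesis by blast
  next
    assume h: "\<xi> 1 \<le> - 2 * b \<and> 2 * b \<le> \<xi> 0"
    have "\<phi> 1 u \<le> u - b \<and> u + b \<le> \<phi> 0 u" for u using near[of u] h by linarith
    then show ?thesis by blast
  qed
qed (use \<phi>_left \<phi>_right b_pos in auto)

end

section \<open>Intermittency\<close>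

lemma (in logistic_perturbation) fibre_iter_eq_orbit:
  assumes "\<And>y x. fibre G y x = g y x" "y \<in> {0..<1}" "0 < x" "x < 1"
  shows "fibre_iter G i y x = sigmoid (orbit (logit x) y i)"
proof (induction i)
  case 0
  show ?case using assms by (simp add: sigmoid_logit)
next
  case (Suc i)
  define u where "u = orbit (logit x) y i"
  have "(E2 ^^ i) y \<in> {0..1}" using E2_iterate_cell[OF assms(2), of i] by auto
  then have "sigmoid (logit (g ((E2 ^^ i) y) (sigmoid u))) = g ((E2 ^^ i) y) (sigmoid u)"
    by (intro sigmoid_logit g_in sigmoid_in)
  moreover have "fibre_iter G (Suc i) y x = g ((E2 ^^ i) y) (sigmoid u)"
    using Suc by (simp add: u_def assms(1))
  moreover have "orbit (logit x) y (Suc i) = logit (g ((E2 ^^ i) y) (sigmoid u))"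
    unfolding orbit.simps u_def by (rule \<phi>_def)
  ultimately show ?case by simp
qed

lemma sigmoid_in_interval:
  assumes "\<bar>u\<bar> \<le> K" "\<epsilon> \<le> sigmoid (- K)"
  shows "sigmoid u \<in> {\<epsilon>..1 - \<epsilon>}"
proof -
  have "sigmoid (- K) \<le> sigmoid u" "sigmoid (- K) \<le> sigmoid (- u)"
    using assms by (auto intro!: sigmoid_mono)
  then show ?thesis using assms(2) one_minus_sigmoid[of u] by auto
qed

lemma abs_le_of_sigmoid_in_interval:
  assumes "0 < \<epsilon>" "sigmoid u \<in> {\<epsilon>..1 - \<epsilon>}"
  shows "\<bar>u\<bar> \<le> - ln \<epsilon>"
proof -
  have s: "0 < sigmoid u" "sigmoid u < 1" by (rule sigmoid_in)+
  have "ln \<epsilon> \<le> ln (sigmoid u)" "ln \<epsilon> \<le> ln (1 - sigmoid u)" using assms s by auto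
  moreover have "ln (sigmoid u) \<le> 0" "ln (1 - sigmoid u) \<le> 0" using s by auto
  moreover have "u = ln (sigmoid u) - ln (1 - sigmoid u)"
    using logit_sigmoid[of u] by (simp add: logit_def)
  ultimately show ?thesis by linarith
qed

text \<open>The witness is \<open>\<epsilon>0 = sigmoid (- K)\<close>. For smaller
  \<open>\<epsilon>\<close> the interval contains the \<open>sigmoid\<close> image of
  \<open>{- K..K}\<close>, which gives recurrence; it is also contained in the image of a compact
  interval with bound \<open>- ln \<epsilon>\<close>, which gives density zero.\<close>

lemma (in logistic_perturbation) intermittency:
  assumes "\<And>y x. fibre G y x = g y x"
  shows "\<exists>\<epsilon>0>0. \<forall>\<epsilon>. 0 < \<epsilon> \<and> \<epsilon> < \<epsilon>0 \<longrightarrow>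
        (\<forall>x\<in>{0<..<1}. AE y in lebesgue_on {0..1}.
          infinite {i. fibre_iter G i y x \<in> {\<epsilon>..1 - \<epsilon>}} \<and>
          (\<lambda>n. (\<Sum>i<n. indicator {\<epsilon>..1 - \<epsilon>} (fibre_iter G i y x)) / real n) \<longlonglongrightarrow> 0)"
proof -
  obtain K where K: "\<And>u0. AE y in lborel. y \<in> {0..<1} \<longrightarrow> infinite {i. \<bar>orbit u0 y i\<bar> \<le> K}"
    using orbit_recurrent by blast
  have "AE y in lebesgue_on {0..1}.
      infinite {i. fibre_iter G i y x \<in> {\<epsilon>..1 - \<epsilon>}} \<and>
      (\<lambda>n. (\<Sum>i<n. indicator {\<epsilon>..1 - \<epsilon>} (fibre_iter G i y x)) / real n) \<longlonglongrightarrow> 0"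
    if \<epsilon>: "0 < \<epsilon>" "\<epsilon> < sigmoid (- K)" and x: "x \<in> {0<..<1}" for \<epsilon> x
  proof -
    have "AE y in lborel. y \<noteq> (1 :: real)" by (rule AE_lborel_singleton)
    with K[of "logit x"] orbit_zero_density[of "logit x" "- ln \<epsilon>"]
    have "AE y in lborel. y \<in> {0..1} \<longrightarrow> infinite {i. fibre_iter G i y x \<in> {\<epsilon>..1 - \<epsilon>}} \<and>
      (\<lambda>n. (\<Sum>i<n. indicator {\<epsilon>..1 - \<epsilon>} (fibre_iter G i y x)) / real n) \<longlonglongrightarrow> 0"
    proof eventually_elim
      case (elim y)
      show ?case
      proof
        assume "y \<in> {0..1}"
        then have y: "y \<in> {0..<1}" using elim(3) by auto
        have it: "fibre_iter G i y x = sigmoid (orbit (logit x) y i)" for i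
          using x by (intro fibre_iter_eq_orbit assms y) auto
        have "{i. \<bar>orbit (logit x) y i\<bar> \<le> K} \<subseteq> {i. fibre_iter G i y x \<in> {\<epsilon>..1 - \<epsilon>}}"
          unfolding it using sigmoid_in_interval \<epsilon>(2) less_imp_le by blast
        then have inf: "infinite {i. fibre_iter G i y x \<in> {\<epsilon>..1 - \<epsilon>}}"
          using elim(1) y infinite_super by blast
        have lim: "(\<lambda>n. (\<Sum>i<n. of_bool (\<bar>orbit (logit x) y i\<bar> \<le> - ln \<epsilon>)) / real n) \<longlonglongrightarrow> 0"
          using elim(2) y by blast
        have upper: "(\<Sum>i<n. indicator {\<epsilon>..1 - \<epsilon>} (fibre_iter G i y x)) / real n
            \<le> (\<Sum>i<n. of_bool (\<bar>orbit (logit x) y i\<bar> \<le> - ln \<epsilon>)) / real n" for n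
          unfolding it using abs_le_of_sigmoid_in_interval[OF \<epsilon>(1)]
          by (intro divide_right_mono sum_mono) (auto simp: indicator_def)
        have lower: "0 \<le> (\<Sum>i<n. indicator {\<epsilon>..1 - \<epsilon>} (fibre_iter G i y x)) / real n" for n
          by (intro divide_nonneg_nonneg sum_nonneg) auto
        have "(\<lambda>n. (\<Sum>i<n. indicator {\<epsilon>..1 - \<epsilon>} (fibre_iter G i y x)) / real n) \<longlonglongrightarrow> 0"
          by (rule tendsto_sandwich[OF always_eventually always_eventually tendsto_const lim])
            (rule allI, rule lower, rule allI, rule upper)
        with inf show "infinite {i. fibre_iter G i y x \<in> {\<epsilon>..1 - \<epsilon>}} \<and>
          (\<lambda>n. (\<Sum>i<n. indicator {\<epsilon>..1 - \<epsilon>} (fibre_iter G i y x)) / real n) \<longlonglongrightarrow> 0" ..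
      qed
    qed
    then have "AE y in lebesgue. y \<in> {0..1} \<longrightarrow> infinite {i. fibre_iter G i y x \<in> {\<epsilon>..1 - \<epsilon>}} \<and>
      (\<lambda>n. (\<Sum>i<n. indicator {\<epsilon>..1 - \<epsilon>} (fibre_iter G i y x)) / real n) \<longlonglongrightarrow> 0"
      by (rule AE_completion)
    then show ?thesis by (rule AE_restrict_space_iff[THEN iffD2, rotated]) simp
  qed
  then show ?thesis using sigmoid_in(1)[of "- K"] by blast
qed

section \<open>Skew maps satisfy the hypotheses on perturbations\<close>

lemma deriv01_eqI:
  assumes "(f has_real_derivative d) (at t within {0..1})" "t \<in> {0..1}"
  shows "deriv01 f t = d"
  unfolding deriv01_def
  using assms vector_derivative_within_cbox[of 0 1 t f d]
  by (simp add: has_real_derivative_iff_has_vector_derivative)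

text \<open>The derivative of the partial derivative is bounded on the compact square, and the mean
  value inequality on this convex set gives the Lipschitz bound.\<close>

lemma smooth_partial_derivative:
  fixes F :: "real \<times> real \<Rightarrow> real"
  assumes "smooth_on ({0..1} \<times> {0..1}) F"
  obtains D B where
    "\<And>y x. \<lbrakk>y \<in> {0..1}; x \<in> {0..1}\<rbrakk> \<Longrightarrow> ((\<lambda>x. F (y, x)) has_real_derivative D y x) (at x within {0..1})"
    "\<And>y x y' x'. \<lbrakk>y \<in> {0..1}; x \<in> {0..1}; y' \<in> {0..1}; x' \<in> {0..1}\<rbrakk> \<Longrightarrow>
      \<bar>D y x - D y' x'\<bar> \<le> B * (\<bar>y - y'\<bar> + \<bar>x - x'\<bar>)"
proof -
  define S where "S = {0..1::real} \<times> {0..1::real}"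
  have "Ck_on (Suc (Suc 0)) S F" using assms unfolding smooth_on_def S_def by blast
  then obtain F' where F': "\<And>p. p \<in> S \<Longrightarrow> (F has_derivative F' p) (at p within S)"
    and "\<And>v. Ck_on (Suc 0) S (\<lambda>p. F' p v)"
    unfolding Ck_on.simps(2)[of "Suc 0"] by blast
  then have "Ck_on (Suc 0) S (\<lambda>p. F' p (0, 1))" by blast
  then obtain F'' where F'': "\<And>p. p \<in> S \<Longrightarrow> ((\<lambda>p. F' p (0, 1)) has_derivative F'' p) (at p within S)"
    and cont: "\<And>v. continuous_on S (\<lambda>p. F'' p v)"
    unfolding Ck_on.simps by blast
  have S: "compact S" "convex S" unfolding S_def by (auto intro: compact_Times convex_Times)
  \<comment> \<open>Continuity is available for each direction \<open>v\<close> separately; by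
    linearity, bounds in the two coordinate directions control the operator norm.\<close>
  have "bounded ((\<lambda>p. F'' p v) ` S)" for v
    using compact_continuous_image[OF cont S(1)] by (rule compact_imp_bounded)
  then have "\<exists>M. \<forall>p\<in>S. \<bar>F'' p v\<bar> \<le> M" for v unfolding bounded_iff by auto
  then obtain M where M: "\<And>v p. p \<in> S \<Longrightarrow> \<bar>F'' p v\<bar> \<le> M v" by metis
  define B where "B = M (1, 0) + M (0, 1)"
  have "(0, 0) \<in> S" by (simp add: S_def)
  then have M0: "0 \<le> M v" for v using M[of "(0, 0)" v] by linarith
  have onorm: "onorm (F'' p) \<le> B" if p: "p \<in> S" for p
  proof (rule onorm_le)
    fix h :: "real \<times> real"
    have lin: "linear (F'' p)" using F''[OF p] has_derivative_linear by blast
    have "h = fst h *\<^sub>R (1, 0) + snd h *\<^sub>R (0, 1)" by (simp add: prod_eq_iff)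
    then have "F'' p h = fst h *\<^sub>R F'' p (1, 0) + snd h *\<^sub>R F'' p (0, 1)"
      using linear_add[OF lin] linear_scale[OF lin] by metis
    then have "norm (F'' p h) \<le> \<bar>fst h\<bar> * \<bar>F'' p (1, 0)\<bar> + \<bar>snd h\<bar> * \<bar>F'' p (0, 1)\<bar>"
      using abs_triangle_ineq[of "fst h * F'' p (1, 0)" "snd h * F'' p (0, 1)"] by (simp add: abs_mult)
    also have "\<dots> \<le> norm h * M (1, 0) + norm h * M (0, 1)"
      using norm_fst_le[of "fst h" "snd h"] norm_snd_le[of "snd h" "fst h"] M[OF p] M0
      by (intro add_mono mult_mono) auto
    finally show "norm (F'' p h) \<le> B * norm h" by (simp add: B_def algebra_simps)
  qed
  show ?thesis
  proof (rule that[of "\<lambda>y x. F' (y, x) (0, 1)" B])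
    fix y x :: real assume yx: "y \<in> {0..1}" "x \<in> {0..1}"
    then have p: "(y, x) \<in> S" by (simp add: S_def)
    have "((\<lambda>x. (y, x)) has_derivative (\<lambda>h. (0, h))) (at x within {0..1})"
      by (auto intro!: derivative_eq_intros)
    moreover have "(F has_derivative F' (y, x)) (at (y, x) within (\<lambda>x. (y, x)) ` {0..1})"
      using F'[OF p] by (rule has_derivative_subset) (use yx in \<open>auto simp: S_def\<close>)
    ultimately have "(F \<circ> (\<lambda>x. (y, x)) has_derivative F' (y, x) \<circ> (\<lambda>h. (0, h))) (at x within {0..1})"
      by (rule diff_chain_within)
    moreover have "F' (y, x) \<circ> (\<lambda>h. (0, h)) = (\<lambda>h. F' (y, x) (0, 1) * h)"
    proof
      fix h :: real
      have "linear (F' (y, x))" using F'[OF p] has_derivative_linear by blast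
      from linear_scale[OF this, of h "(0, 1)"]
      show "(F' (y, x) \<circ> (\<lambda>h. (0, h))) h = F' (y, x) (0, 1) * h" by (simp add: mult.commute)
    qed
    ultimately show "((\<lambda>x. F (y, x)) has_real_derivative F' (y, x) (0, 1)) (at x within {0..1})"
      by (simp add: has_field_derivative_def comp_def)
  next
    fix y x y' x' :: real assume h: "y \<in> {0..1}" "x \<in> {0..1}" "y' \<in> {0..1}" "x' \<in> {0..1}"
    have "norm (F' (y, x) (0, 1) - F' (y', x') (0, 1)) \<le> B * norm ((y, x) - (y', x'))"
      using h by (intro differentiable_bound[OF S(2) F'' onorm]) (auto simp: S_def)
    also have "\<dots> \<le> B * (\<bar>y - y'\<bar> + \<bar>x - x'\<bar>)"
      using M0 norm_Pair_le[of "y - y'" "x - x'"] by (intro mult_left_mono) (auto simp: B_def)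
    finally show "\<bar>F' (y, x) (0, 1) - F' (y', x') (0, 1)\<bar> \<le> B * (\<bar>y - y'\<bar> + \<bar>x - x'\<bar>)" by simp
  qed
qed

lemma skew_map_logistic_perturbation:
  assumes G: "G \<in> skew_maps \<xi> C r0"
    and lyap: "lyapunov G 0 = 0" "lyapunov G 1 = 0"
    and \<xi>: "\<And>y. y \<in> {0..1} \<Longrightarrow> \<bar>\<xi> y\<bar> \<le> X"
    and r0: "0 \<le> r0" "r0 * exp (2 * X) \<le> 1 / 10" "4 * (r0 * exp X) \<le> b"
    and b: "0 < b" "\<xi> 0 \<le> - 2 * b \<and> 2 * b \<le> \<xi> 1 \<or> \<xi> 1 \<le> - 2 * b \<and> 2 * b \<le> \<xi> 0"
  shows "\<exists>D B. logistic_perturbation (fibre G) D \<xi> X r0 B b"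
proof -
  have "smooth_on ({0..1} \<times> {0..1}) (\<lambda>(y, x). fibre G y x)" using G by (simp add: skew_maps_def)
  from smooth_partial_derivative[OF this] obtain D B where
    D: "\<And>y x. \<lbrakk>y \<in> {0..1}; x \<in> {0..1}\<rbrakk> \<Longrightarrow> (fibre G y has_real_derivative D y x) (at x within {0..1})"
    and B: "\<And>y x y' x'. \<lbrakk>y \<in> {0..1}; x \<in> {0..1}; y' \<in> {0..1}; x' \<in> {0..1}\<rbrakk> \<Longrightarrow>
      \<bar>D y x - D y' x'\<bar> \<le> B * (\<bar>y - y'\<bar> + \<bar>x - x'\<bar>)"
    by auto
  have rem: "\<bar>remainder \<xi> G y x\<bar> \<le> C * x\<^sup>2" "\<bar>remainder \<xi> G y x\<bar> \<le> C * \<bar>1 - x\<bar>"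
    "\<bar>deriv01 (\<lambda>t. remainder \<xi> G y t) x\<bar> \<le> r0" if "y \<in> {0..1}" "x \<in> {0..1}" for y x
    using G that by (auto simp: skew_maps_def)
  have lyap_int: "integral {0..1} (\<lambda>y. ln (D y p)) = lyapunov G p" if "p \<in> {0..1}" for p
    unfolding lyapunov_def using that by (intro Henstock_Kurzweil_Integration.integral_cong) (simp add: deriv01_eqI[OF D])
  have "logistic_perturbation (fibre G) D \<xi> X r0 B b"
  proof
    show "(fibre G y has_real_derivative D y x) (at x within {0..1})" if "y \<in> {0..1}" "x \<in> {0..1}" for y x
      using that by (rule D)
    \<comment> \<open>The bounds \<open>C * x\<^sup>2\<close> and
      \<open>C * \<bar>1 - x\<bar>\<close> force the remainder to vanish at 0 and at 1.\<close>
    show "fibre G y 0 = 0" "fibre G y 1 = 1" if "y \<in> {0..1}" for y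
      using rem(1)[OF that, of 0] rem(2)[OF that, of 1] by (auto simp: remainder_def)
    show "\<bar>D y x - exp (\<xi> y) / (1 + (exp (\<xi> y) - 1) * x)\<^sup>2\<bar> \<le> r0" if "y \<in> {0..1}" "x \<in> {0..1}" for y x
    proof -
      have "((\<lambda>t. remainder \<xi> G y t) has_real_derivative
          D y x - exp (\<xi> y) / (1 + (exp (\<xi> y) - 1) * x)\<^sup>2) (at x within {0..1})"
        unfolding remainder_def
        using logistic_denominator_pos[OF exp_gt_zero that(2), of "\<xi> y"]
        by (intro DERIV_diff D that logistic_derivative) auto
      then show ?thesis using rem(3)[OF that] deriv01_eqI[OF _ that(2)] by metis
    qed
  qed (use assms B lyap_int in auto)
  then show ?thesis by blast
qed

text \<open>With the wrong sign at an end, \<open>f\<close> or \<open>- f\<close> would be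
  nonnegative with integral zero, hence identically zero by continuity, against strict
  monotonicity.\<close>

lemma strict_mono_mean_zero_ends:
  fixes f :: "real \<Rightarrow> real"
  assumes "continuous_on {0..1} f" "strict_mono_on {0..1} f" "integral {0..1} f = 0"
  shows "f 0 < 0" "0 < f 1"
proof -
  have less: "f s < f t" if "s \<in> {0..1}" "t \<in> {0..1}" "s < t" for s t
    using assms(2) that by (auto simp: strict_mono_on_def)
  show "f 0 < 0"
  proof (rule ccontr)
    assume "\<not> f 0 < 0"
    then have "0 \<le> f t" if "t \<in> {0..1}" for t using less[of 0 t] that by (cases "t = 0") auto
    then have "\<forall>t\<in>{0..1}. f t = 0"
      using integral_eq_0_iff[OF assms(1)] assms(3) by simp
    then show False using less[of 0 1] by simp
  qed
  show "0 < f 1"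
  proof (rule ccontr)
    assume "\<not> 0 < f 1"
    then have "0 \<le> - f t" if "t \<in> {0..1}" for t using less[of t 1] that by (cases "t = 1") auto
    moreover have "integral {0..1} (\<lambda>t. - f t) = 0" using assms(3) by simp
    ultimately have "\<forall>t\<in>{0..1}. - f t = 0"
      using integral_eq_0_iff[OF continuous_on_minus[OF assms(1)]] by simp
    then show False using less[of 0 1] by simp
  qed
qed

theorem theorem1p3:
  fixes \<xi> :: "real \<Rightarrow> real" and C :: real
  assumes "smooth_on {0..1} \<xi>"
    and "strict_mono_on {0..1} \<xi> \<or> strict_antimono_on {0..1} \<xi>"
    and "integral {0..1} \<xi> = 0"
    and "C > 0"
  shows "\<exists>r1>0. \<forall>r0. 0 < r0 \<and> r0 < r1 \<longrightarrow>
    (\<forall>G\<in>skew_maps \<xi> C r0. lyapunov G 0 = 0 \<and> lyapunov G 1 = 0 \<longrightarrow>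
      (\<exists>\<epsilon>0>0. \<forall>\<epsilon>. 0 < \<epsilon> \<and> \<epsilon> < \<epsilon>0 \<longrightarrow>
        (\<forall>x\<in>{0<..<1}. AE y in lebesgue_on {0..1}.
          infinite {i. fibre_iter G i y x \<in> {\<epsilon>..1 - \<epsilon>}} \<and>
          (\<lambda>n. (\<Sum>i<n. indicator {\<epsilon>..1 - \<epsilon>} (fibre_iter G i y x)) / real n) \<longlonglongrightarrow> 0)))"
proof -
  have "Ck_on 0 {0..1} \<xi>" using assms(1) unfolding smooth_on_def by blast
  then have cont: "continuous_on {0..1} \<xi>" by simp
  have "bounded (\<xi> ` {0..1})"
    using compact_continuous_image[OF cont] by (simp add: compact_imp_bounded)
  then obtain X where "\<forall>y\<in>{0..1}. \<bar>\<xi> y\<bar> \<le> X" unfolding bounded_iff by auto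
  then have X: "\<bar>\<xi> y\<bar> \<le> X" if "y \<in> {0..1}" for y using that by blast
  have "\<xi> 0 < 0 \<and> 0 < \<xi> 1 \<or> \<xi> 1 < 0 \<and> 0 < \<xi> 0"
    using assms(2)
  proof
    assume "strict_mono_on {0..1} \<xi>"
    then show ?thesis using strict_mono_mean_zero_ends[OF cont] assms(3) by blast
  next
    assume "strict_antimono_on {0..1} \<xi>"
    then have "strict_mono_on {0..1} (\<lambda>y. - \<xi> y)" by (auto simp: monotone_on_def)
    then show ?thesis
      using strict_mono_mean_zero_ends[OF continuous_on_minus[OF cont]] assms(3) by auto
  qed
  \<comment> \<open>Half of the smaller modulus at the two ends: the perturbation may consume one
    half, the other remains as guaranteed motion.\<close>
  moreover define b where "b = min \<bar>\<xi> 0\<bar> \<bar>\<xi> 1\<bar> / 2"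
  ultimately have b: "0 < b" "\<xi> 0 \<le> - 2 * b \<and> 2 * b \<le> \<xi> 1 \<or> \<xi> 1 \<le> - 2 * b \<and> 2 * b \<le> \<xi> 0"
    by auto
  \<comment> \<open>The two entries are \<open>r0_small\<close> and \<open>r0_b\<close> solved for
    \<open>r0\<close>.\<close>
  define r1 where "r1 = min (1 / (10 * exp (2 * X))) (b / (4 * exp X))"
  have "0 < r1" using b by (simp add: r1_def)
  moreover have "\<exists>\<epsilon>0>0. \<forall>\<epsilon>. 0 < \<epsilon> \<and> \<epsilon> < \<epsilon>0 \<longrightarrow>
        (\<forall>x\<in>{0<..<1}. AE y in lebesgue_on {0..1}.
          infinite {i. fibre_iter G i y x \<in> {\<epsilon>..1 - \<epsilon>}} \<and>
          (\<lambda>n. (\<Sum>i<n. indicator {\<epsilon>..1 - \<epsilon>} (fibre_iter G i y x)) / real n) \<longlonglongrightarrow> 0)"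
    if r0: "0 < r0" "r0 < r1" and G: "G \<in> skew_maps \<xi> C r0" "lyapunov G 0 = 0" "lyapunov G 1 = 0" for r0 G
  proof -
    have "r0 * exp (2 * X) \<le> 1 / 10" "4 * (r0 * exp X) \<le> b"
      using r0(2) by (auto simp: r1_def field_simps)
    then obtain D B where "logistic_perturbation (fibre G) D \<xi> X r0 B b"
      using skew_map_logistic_perturbation[OF G X] r0(1) b by fastforce
    then interpret logistic_perturbation "fibre G" D \<xi> X r0 B b .
    show ?thesis by (rule intermittency[OF refl])
  qed
  ultimately show ?thesis by blast
qed

end
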